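(* There exists $C>0$ (independent of $u$, $r$ and $\sigma$) such that the following holds. Let $u \in L^{\infty}(\mathbb{B}_n)$ and $r>1$. If $\sigma \in u B_1 \cap \mathrm{RH}_r$, then $T_u$ acts boundedly from $L^1_{\sigma}$ to $L^{1,\infty}_{\sigma}$ with $$\|T_u\|_{L^1_{\sigma}\rightarrow L^{1,\infty}_{\sigma}}\leq C\, [\sigma]_{uB_1}[\sigma]_{\mathrm{RH}_r}(1+\log r'),$$ where $r'=r/(r-1)$.
   Context: $\mathbb{B}_n$ is the open unit ball of $\mathbb{C}^n$, $V$ is normalized Lebesgue measure on $\mathbb{B}_n$, $|A|=V(A)$, $z\overline{w}=\sum_{j=1}^n z_j\overline{w}_j$. For $u\in L^\infty$ the Toeplitz operator is $T_uf(z)=\int_{\mathbb{B}_n}\frac{u(w)f(w)}{(1-z\overline{w})^{n+1}}\,dV(w)$. A weight is a locally integrable function on $\mathbb{B}_n$ that is positive almost everywhere; $\sigma(A)=\int_A\sigma\,dV$; $\langle f\rangle_A=\frac{1}{|A|}\int_A f\,dV$; $\|f\|_{L^1_\sigma}=\int_{\mathbb{B}_n}|f|\sigma\,dV$; $\|f\|_{L^{1,\infty}_\sigma}=\sup_{\lambda>0}\lambda\,\sigma(\{z:|f(z)|>\lambda\})$. $\|T\|_{L^1_\sigma\to L^{1,\infty}_\sigma}$ is the smallest constant $A$ with $\|Tf\|_{L^{1,\infty}_\sigma}\le A\|f\|_{L^1_\sigma}$ for all $f$. Dyadic structure. The Carleson tent over $z\in\mathbb{B}_n\setminus\{0\}$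 is $\mathcal{T}_z=\{w\in\mathbb{B}_n: |1-\overline{w}\frac{z}{|z|}|<1-|z|\}$, and $\mathcal{T}_0=\mathbb{B}_n$. Let $\phi_z$ be the involutive automorphism of $\mathbb{B}_n$ interchanging $z$ and $0$, $\beta(z,w)=\frac12\log\frac{1+|\phi_z(w)|}{1-|\phi_z(w)|}$ the Bergman metric, and $B_\beta(z,s)$ its balls. Fix $\theta_0,\lambda_0>0$. For $k\geq1$ let $\mathbb{S}_{k\theta_0}=\{z:\beta(0,z)=k\theta_0\}$, and choose points $w_j^k$ and Borel sets $Q_j^k\subseteq\mathbb{S}_{k\theta_0}$ containing $w_j^k$ ($1\le j\le J_k$), pairwise disjoint for fixed $k$, with union $\mathbb{S}_{k\theta_0}$, and such that $\mathbb{S}_{k\theta_0}\cap B_\beta(w_j^k,\lambda_0)\subseteq Q_j^k\subseteq\mathbb{S}_{k\theta_0}\cap B_\beta(w_j^k,C_0\lambda_0)$ for a constant $C_0>1$. Let $P_{s}z$ be the radial projection of $z$ onto $\{\beta(0,\cdot)=s\}$. The kubes are $K_1^0=B_\beta(0,\theta_0)$ and $K_j^k=\{z: k\theta_0<\beta(0,z)\le(k+1)\theta_0,\ P_{k\theta_0}z\in Q_j^k\}$, $k\geq1$; the center of $K_j^k$ is $c_j^k=P_{(k+\frac12)\theta_0}w_j^k$ and its generation is $k$. For $k_1>k_2\ge1$, $K_{j_1}^{k_1}$ is a descendant of $K_{j_2}^{k_2}$ if $P_{k_2\theta_0}c_{j_1}^{k_1}\in Q_{j_2}^{k_2}$ (a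 child if $k_1=k_2+1$); all kubes of generation $\ge 1$ are descendants of $K_1^0$, those of generation 1 being its children. The dyadic tent $\widehat{K}$ is the union of $K$ and all its descendants. A dyadic structure is the collection of kubes so obtained. One fixes a finite collection $\mathcal{D}_1,\dots,\mathcal{D}_M$ of such structures so that, in each $\mathcal{D}_\ell$, two tents are either disjoint or nested and $|K|\approx|\widehat{K}|\approx(1-|c_K|^2)^{n+1}$ uniformly, and so that every Carleson tent is contained in some tent $\widehat{K}$ of comparable measure, and every $\widehat{K}$ is contained in some Carleson tent of comparable measure. Put $\mathcal{D}=\bigcup_{\ell=1}^M\mathcal{D}_\ell$. A weight $\sigma$ is in $uB_1$ if $[\sigma]_{uB_1}=\sup_{K\in\mathcal{D}}\|u\|_{L^\infty(\widehat{K})}\langle\sigma\rangle_{\widehat{K}}\|\sigma^{-1}\|_{L^\infty(\widehat{K})}<\infty$, and in $\mathrm{RH}_r$ if $[\sigma]_{\mathrm{RH}_r}=\sup_{K\in\mathcal{D}}\langle\sigma^r\rangle_{\widehat{K}}^{1/r}/\langle\sigma\rangle_{\widehat{K}}<\infty$.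
   Formalization: The root kube $K_1^0$ is taken to be the closed Bergman ball of radius $\theta_0$: with the open ball the null sphere $\beta(0,z)=\theta_0$ lies in no kube, so no tent could contain the Carleson tent $\mathcal{T}_0=\mathbb{B}_n$; only a null set changes. *)

theory Defs
  imports "HOL-Analysis.Analysis" "HOL-Probability.Essential_Supremum"
begin

section \<open>The unit ball of complex n-space\<close>

text \<open>Complex n-space is \<open>complex ^ 'n\<close> with \<open>n = CARD('n)\<close>; its norm is the Euclidean one.\<close>

abbreviation unit_ball :: "(complex ^ 'n) set" where
  "unit_ball \<equiv> ball 0 1"

text \<open>Normalized Lebesgue measure; its underlying space is the ball itself.\<close>

definition V :: "(complex ^ 'n) measure" where
  "V = restrict_space (uniform_measure lebesgue unit_ball) unit_ball"

definition herm :: "complex ^ 'n \<Rightarrow> complex ^ 'n \<Rightarrow> complex" where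
  "herm z w = (\<Sum>j\<in>UNIV. z $ j * cnj (w $ j))"

definition carleson_tent :: "complex ^ 'n \<Rightarrow> (complex ^ 'n) set" where
  "carleson_tent z =
     (if z = 0 then unit_ball
      else {w \<in> unit_ball. norm (1 - herm (z /\<^sub>R norm z) w) < 1 - norm z})"

text \<open>The involutive automorphism interchanging \<open>a\<close> and \<open>0\<close>, in Rudin's form
  \<open>(a - P w - s (w - P w)) / (1 - <w,a>)\<close> with \<open>P\<close> the orthogonal projection onto the
  complex line through \<open>a\<close> and \<open>s = sqrt (1 - |a|^2)\<close>. For \<open>a = 0\<close> division by zero gives
  \<open>P = 0\<close>, hence \<open>moebius 0 w = - w\<close>, as it should be.\<close>

definition moebius :: "complex ^ 'n \<Rightarrow> complex ^ 'n \<Rightarrow> complex ^ 'n" where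
  "moebius a w =
     (let p = (herm w a / herm a a) *s a
      in (1 / (1 - herm w a)) *s (a - p - sqrt (1 - (norm a)\<^sup>2) *\<^sub>R (w - p)))"

definition bergman :: "complex ^ 'n \<Rightarrow> complex ^ 'n \<Rightarrow> real" where
  "bergman z w = ln ((1 + norm (moebius z w)) / (1 - norm (moebius z w))) / 2"

definition bergman_ball :: "complex ^ 'n \<Rightarrow> real \<Rightarrow> (complex ^ 'n) set" where
  "bergman_ball z s = {w \<in> unit_ball. bergman z w < s}"

definition bergman_sphere :: "real \<Rightarrow> (complex ^ 'n) set" where
  "bergman_sphere s = {z \<in> unit_ball. bergman 0 z = s}"

text \<open>Radial projection onto \<open>bergman_sphere s\<close>, whose Euclidean radius is \<open>tanh s\<close>;
  see \<open>radial_proj_in_sphere\<close> below.\<close>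

definition radial_proj :: "real \<Rightarrow> complex ^ 'n \<Rightarrow> complex ^ 'n" where
  "radial_proj s z = (tanh s / norm z) *\<^sub>R z"

lemma herm_self: "herm a a = of_real ((norm a)\<^sup>2)"
proof -
  have "(norm a)\<^sup>2 = (\<Sum>j\<in>UNIV. (cmod (a $ j))\<^sup>2)"
    by (simp add: norm_vec_def L2_set_def sum_nonneg)
  then show ?thesis
    by (simp add: herm_def complex_norm_square del: of_real_power)
qed

lemma moebius_0: "moebius 0 w = - w"
  by (simp add: moebius_def herm_def Let_def vec_eq_iff)

lemma moebius_at_0: "moebius a 0 = a"
  by (simp add: moebius_def herm_def Let_def vec_eq_iff)

lemma moebius_at_self: "moebius a a = 0"
  by (cases "a = 0") (auto simp: moebius_def herm_self Let_def vec_eq_iff)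

lemma bergman_0: "bergman 0 z = artanh (norm z)"
  by (simp add: bergman_def moebius_0 artanh_def)

lemma radial_proj_in_sphere:
  assumes "z \<noteq> 0" "s \<ge> 0"
  shows "radial_proj s z \<in> bergman_sphere s"
  using assms tanh_real_lt_1[of s]
  by (simp add: bergman_sphere_def bergman_0 radial_proj_def artanh_tanh_real)


section \<open>Dyadic structures\<close>

text \<open>The choices from which a dyadic structure is built: the number \<open>J\<^sub>k\<close> of cells of
  generation \<open>k\<close>, the points \<open>w\<^sub>j\<^sup>k\<close> (\<open>point k j\<close>) and the sets \<open>Q\<^sub>j\<^sup>k\<close> (\<open>cell k j\<close>).\<close>

record ('n::finite) dyadic_data =
  num :: "nat \<Rightarrow> nat"
  point :: "nat \<Rightarrow> nat \<Rightarrow> complex ^ 'n"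
  cell :: "nat \<Rightarrow> nat \<Rightarrow> (complex ^ 'n) set"

definition is_dyadic_data ::
    "real \<Rightarrow> real \<Rightarrow> real \<Rightarrow> 'n::finite dyadic_data \<Rightarrow> bool" where
  "is_dyadic_data \<theta> lam C0 S \<longleftrightarrow>
     (\<forall>k\<ge>1.
        (\<forall>j\<in>{1..num S k}.
           cell S k j \<in> sets borel \<and>
           point S k j \<in> cell S k j \<and>
           bergman_sphere (real k * \<theta>) \<inter> bergman_ball (point S k j) lam \<subseteq> cell S k j \<and>
           cell S k j \<subseteq> bergman_sphere (real k * \<theta>) \<inter> bergman_ball (point S k j) (C0 * lam)) \<and>
        disjoint_family_on (cell S k) {1..num S k} \<and>
        (\<Union>j\<in>{1..num S k}. cell S k j) = bergman_sphere (real k * \<theta>))"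

text \<open>A kube is addressed by its generation \<open>k\<close> and its index \<open>j\<close>.\<close>

definition kube_index :: "'n::finite dyadic_data \<Rightarrow> (nat \<times> nat) set" where
  "kube_index S = {(0, 1)} \<union> {(k, j). 1 \<le> k \<and> 1 \<le> j \<and> j \<le> num S k}"

text \<open>The root kube is the closed ball of radius \<open>\<theta>\<close>. Generation 1 starts strictly beyond
  radius \<open>\<theta>\<close>, so with the open ball the null set \<open>bergman_sphere \<theta>\<close> would lie in no kube, and
  no dyadic tent could contain the Carleson tent over 0, which is the whole unit ball.\<close>

fun kube :: "real \<Rightarrow> 'n::finite dyadic_data \<Rightarrow> nat \<times> nat \<Rightarrow> (complex ^ 'n) set" where
  "kube \<theta> S (k, j) =
     (if k = 0 then {z \<in> unit_ball. bergman 0 z \<le> \<theta>}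
      else {z \<in> unit_ball. real k * \<theta> < bergman 0 z \<and> bergman 0 z \<le> real (k + 1) * \<theta> \<and>
              radial_proj (real k * \<theta>) z \<in> cell S k j})"

fun kube_center :: "real \<Rightarrow> 'n::finite dyadic_data \<Rightarrow> nat \<times> nat \<Rightarrow> complex ^ 'n" where
  "kube_center \<theta> S (k, j) =
     (if k = 0 then 0 else radial_proj ((real k + 1/2) * \<theta>) (point S k j))"

text \<open>\<open>descendant \<theta> S p q\<close>: the kube \<open>p\<close> is a (proper) descendant of the kube \<open>q\<close>.\<close>

fun descendant :: "real \<Rightarrow> 'n::finite dyadic_data \<Rightarrow> nat \<times> nat \<Rightarrow> nat \<times> nat \<Rightarrow> bool" where
  "descendant \<theta> S (k1, j1) (k2, j2) \<longleftrightarrow>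
     k2 < k1 \<and>
     (k2 = 0 \<or> radial_proj (real k2 * \<theta>) (kube_center \<theta> S (k1, j1)) \<in> cell S k2 j2)"

definition dyadic_tent :: "real \<Rightarrow> 'n::finite dyadic_data \<Rightarrow> nat \<times> nat \<Rightarrow> (complex ^ 'n) set" where
  "dyadic_tent \<theta> S q =
     kube \<theta> S q \<union> (\<Union>p\<in>{p \<in> kube_index S. descendant \<theta> S p q}. kube \<theta> S p)"

definition comparable :: "real \<Rightarrow> ennreal \<Rightarrow> ennreal \<Rightarrow> bool" where
  "comparable c x y \<longleftrightarrow> x \<le> ennreal c * y \<and> y \<le> ennreal c * x"

text \<open>A finite collection of dyadic structures with common parameters \<open>\<theta>\<close>, \<open>lam\<close>, \<open>C0\<close>
  that has all the properties required of it; \<open>c\<close> is the uniform comparability constant.\<close>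

definition dyadic_family ::
    "real \<Rightarrow> real \<Rightarrow> real \<Rightarrow> 'n::finite dyadic_data set \<Rightarrow> bool" where
  "dyadic_family \<theta> lam C0 \<D> \<longleftrightarrow>
     0 < \<theta> \<and> 0 < lam \<and> 1 < C0 \<and>
     finite \<D> \<and>
     (\<forall>S\<in>\<D>. is_dyadic_data \<theta> lam C0 S) \<and>
     (\<forall>S\<in>\<D>. \<forall>p\<in>kube_index S. \<forall>q\<in>kube_index S.
        dyadic_tent \<theta> S p \<inter> dyadic_tent \<theta> S q = {} \<or>
        dyadic_tent \<theta> S p \<subseteq> dyadic_tent \<theta> S q \<or>
        dyadic_tent \<theta> S q \<subseteq> dyadic_tent \<theta> S p) \<and>
     (\<exists>c>0.
        (\<forall>S\<in>\<D>. \<forall>p\<in>kube_index S.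
           comparable c (emeasure V (kube \<theta> S p)) (emeasure V (dyadic_tent \<theta> S p)) \<and>
           comparable c (emeasure V (dyadic_tent \<theta> S p))
             (ennreal ((1 - (norm (kube_center \<theta> S p))\<^sup>2) ^ (CARD('n) + 1)))) \<and>
        (\<forall>z\<in>unit_ball. \<exists>S\<in>\<D>. \<exists>p\<in>kube_index S.
           carleson_tent z \<subseteq> dyadic_tent \<theta> S p \<and>
           comparable c (emeasure V (carleson_tent z)) (emeasure V (dyadic_tent \<theta> S p))) \<and>
        (\<forall>S\<in>\<D>. \<forall>p\<in>kube_index S. \<exists>z\<in>unit_ball.
           dyadic_tent \<theta> S p \<subseteq> carleson_tent z \<and>
           comparable c (emeasure V (carleson_tent z)) (emeasure V (dyadic_tent \<theta> S p))))"

definition tents :: "real \<Rightarrow> 'n::finite dyadic_data set \<Rightarrow> (complex ^ 'n) set set" where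
  "tents \<theta> \<D> = (\<Union>S\<in>\<D>. dyadic_tent \<theta> S ` kube_index S)"


section \<open>Weights\<close>

definition weight :: "(complex ^ 'n \<Rightarrow> real) \<Rightarrow> bool" where
  "weight \<sigma> \<longleftrightarrow>
     \<sigma> \<in> borel_measurable V \<and>
     (\<forall>K. compact K \<and> K \<subseteq> unit_ball \<longrightarrow> set_integrable V K \<sigma>) \<and>
     (AE x in V. 0 < \<sigma> x)"

definition wmeasure :: "(complex ^ 'n \<Rightarrow> real) \<Rightarrow> (complex ^ 'n) set \<Rightarrow> ennreal" where
  "wmeasure \<sigma> A = (\<integral>\<^sup>+x\<in>A. ennreal (\<sigma> x) \<partial>V)"

definition avg :: "(complex ^ 'n \<Rightarrow> real) \<Rightarrow> (complex ^ 'n) set \<Rightarrow> ennreal" where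
  "avg f A = (\<integral>\<^sup>+x\<in>A. ennreal (f x) \<partial>V) / emeasure V A"

text \<open>The \<open>L\<^sup>\<infinity>\<close> norm over \<open>A\<close> of a function with absolute value \<open>g\<close>.\<close>

definition sup_norm_on :: "(complex ^ 'n) set \<Rightarrow> (complex ^ 'n \<Rightarrow> ennreal) \<Rightarrow> ennreal" where
  "sup_norm_on A g = esssup (restrict_space V A) g"

definition L_infinity :: "(complex ^ 'n \<Rightarrow> complex) set" where
  "L_infinity =
     {u \<in> borel_measurable V. sup_norm_on unit_ball (\<lambda>x. ennreal (norm (u x))) < \<infinity>}"

definition ennreal_root :: "real \<Rightarrow> ennreal \<Rightarrow> ennreal" where
  "ennreal_root r x = (if x = \<infinity> then \<infinity> else ennreal (enn2real x powr (1 / r)))"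

text \<open>Both characteristics are \<open>[0,\<infinity>]\<close>-valued. The conventions \<open>0 * \<infinity> = 0\<close> and
  \<open>\<infinity> / \<infinity> = 0\<close> only play a role when \<open>u = 0\<close> almost everywhere: the union of the root kube and
  its descendants is the whole ball, so if \<open>u\<close> is not 0 a.e., finiteness of \<open>uB1_char\<close> forces
  \<open>\<sigma>\<close> to be integrable and its inverse to be bounded on the ball.\<close>

definition uB1_char ::
    "real \<Rightarrow> 'n::finite dyadic_data set \<Rightarrow> (complex ^ 'n \<Rightarrow> complex) \<Rightarrow> (complex ^ 'n \<Rightarrow> real) \<Rightarrow> ennreal" where
  "uB1_char \<theta> \<D> u \<sigma> =
     (SUP A\<in>tents \<theta> \<D>. sup_norm_on A (\<lambda>x. ennreal (norm (u x))) * avg \<sigma> A *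
        sup_norm_on A (\<lambda>x. inverse (ennreal (\<sigma> x))))"

definition uB1 ::
    "real \<Rightarrow> 'n::finite dyadic_data set \<Rightarrow> (complex ^ 'n \<Rightarrow> complex) \<Rightarrow> (complex ^ 'n \<Rightarrow> real) set" where
  "uB1 \<theta> \<D> u = {\<sigma>. weight \<sigma> \<and> uB1_char \<theta> \<D> u \<sigma> < \<infinity>}"

definition RH_char ::
    "real \<Rightarrow> 'n::finite dyadic_data set \<Rightarrow> real \<Rightarrow> (complex ^ 'n \<Rightarrow> real) \<Rightarrow> ennreal" where
  "RH_char \<theta> \<D> r \<sigma> =
     (SUP A\<in>tents \<theta> \<D>. ennreal_root r (avg (\<lambda>x. \<sigma> x powr r) A) / avg \<sigma> A)"

definition RH ::
    "real \<Rightarrow> 'n::finite dyadic_data set \<Rightarrow> real \<Rightarrow> (complex ^ 'n \<Rightarrow> real) set" where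
  "RH \<theta> \<D> r = {\<sigma>. weight \<sigma> \<and> RH_char \<theta> \<D> r \<sigma> < \<infinity>}"


section \<open>Weighted spaces and Toeplitz operators\<close>

definition L1_norm :: "(complex ^ 'n \<Rightarrow> real) \<Rightarrow> (complex ^ 'n \<Rightarrow> complex) \<Rightarrow> ennreal" where
  "L1_norm \<sigma> f = (\<integral>\<^sup>+x. ennreal (norm (f x)) * ennreal (\<sigma> x) \<partial>V)"

definition L1 :: "(complex ^ 'n \<Rightarrow> real) \<Rightarrow> (complex ^ 'n \<Rightarrow> complex) set" where
  "L1 \<sigma> = {f \<in> borel_measurable V. L1_norm \<sigma> f < \<infinity>}"

definition weak_L1_norm :: "(complex ^ 'n \<Rightarrow> real) \<Rightarrow> (complex ^ 'n \<Rightarrow> complex) \<Rightarrow> ennreal" where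
  "weak_L1_norm \<sigma> f = (SUP t\<in>{0<..}. ennreal t * wmeasure \<sigma> {z \<in> unit_ball. t < norm (f z)})"

definition weak_L1 :: "(complex ^ 'n \<Rightarrow> real) \<Rightarrow> (complex ^ 'n \<Rightarrow> complex) set" where
  "weak_L1 \<sigma> = {f \<in> borel_measurable V. weak_L1_norm \<sigma> f < \<infinity>}"

definition toeplitz_integrand ::
    "(complex ^ 'n \<Rightarrow> complex) \<Rightarrow> (complex ^ 'n \<Rightarrow> complex) \<Rightarrow> complex ^ 'n \<Rightarrow> complex ^ 'n \<Rightarrow> complex" where
  "toeplitz_integrand u f z w = u w * f w / (1 - herm z w) ^ (CARD('n) + 1)"

definition toeplitz ::
    "(complex ^ 'n \<Rightarrow> complex) \<Rightarrow> (complex ^ 'n \<Rightarrow> complex) \<Rightarrow> complex ^ 'n \<Rightarrow> complex" where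
  "toeplitz u f z = (\<integral>w. toeplitz_integrand u f z w \<partial>V)"

definition weak_opnorm ::
    "(complex ^ 'n \<Rightarrow> real) \<Rightarrow> ((complex ^ 'n \<Rightarrow> complex) \<Rightarrow> (complex ^ 'n \<Rightarrow> complex)) \<Rightarrow> ennreal" where
  "weak_opnorm \<sigma> T = Inf {A. \<forall>f\<in>L1 \<sigma>. weak_L1_norm \<sigma> (T f) \<le> A * L1_norm \<sigma> f}"

text \<open>Besides finiteness of the norm, the defining integral is required to converge absolutely
  at every point of the ball, since the Bochner integral of a non-integrable function is 0.\<close>

definition toeplitz_bounded ::
    "(complex ^ 'n \<Rightarrow> real) \<Rightarrow> (complex ^ 'n \<Rightarrow> complex) \<Rightarrow> bool" where
  "toeplitz_bounded \<sigma> u \<longleftrightarrow>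
     (\<forall>f\<in>L1 \<sigma>. (\<forall>z\<in>unit_ball. integrable V (toeplitz_integrand u f z)) \<and>
        toeplitz u f \<in> weak_L1 \<sigma>) \<and>
     weak_opnorm \<sigma> (toeplitz u) < \<infinity>"

end

theory Submission
  imports Defs "HOL-Probability.Probability_Measure"
begin

text \<open>
  Why the bound holds. The Bergman kernel at \<open>(z, w)\<close> has size \<open>d\<^sup>-\<^sup>(\<^sup>n\<^sup>+\<^sup>1\<^sup>)\<close> with \<open>d = |1 - z w|\<close>
  (the Hermitian product), and \<open>z\<close> and \<open>w\<close> lie in a common Carleson tent of height about \<open>d\<close>,
  whose volume is at most a constant times \<open>d\<^sup>n\<^sup>+\<^sup>1\<close>. Enlarging it to a dyadic tent of comparable
  volume shows that \<open>|T f|\<close> is at most a constant times the sum, over the finitely many dyadic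
  structures, of \<open>z \<mapsto> \<Sum>\<^sub>K \<langle>|u f|\<rangle>\<^sub>K 1\<^sub>K(z)\<close>, where \<open>K\<close> ranges over the dyadic tents
  (\<open>kernel_sparse_domination\<close>).

  The tents of one structure form a tree in which the next generation covers only a proportion
  \<open>\<rho> < 1\<close> of each tent, because every kube takes up a fixed part of its tent. For any such tree
  the sum of averages satisfies a weak-type inequality (\<open>tent_tree.weak_type\<close>): the \<open>\<sigma>\<close>-measure of
  \<open>{\<Sum>\<^sub>K \<langle>g\<rangle>\<^sub>K 1\<^sub>K > 1}\<close> is at most a constant times \<open>1 + log r'\<close> times the integral of \<open>g\<close> against
  the maximal function \<open>sup\<^sub>K \<langle>\<sigma>\<^sup>r\<rangle>\<^sub>K\<^sup>1\<^sup>/\<^sup>r\<close>. The proof follows the scheme of Domingo-Salazar, Lacey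
  and Rey. The tents are sorted by the size \<open>2\<^sup>-\<^sup>k\<close> of the average of \<open>g\<close>. Each class, tested against
  \<open>\<sigma>\<close>, costs a constant multiple of the right-hand integral, by a Carleson embedding argument. For the first
  \<open>k\<^sub>0\<close> classes, \<open>2\<^sup>k\<^sup>0\<close> being about \<open>r'\<close>, this is accepted, which produces the logarithm. In
  the later classes only the part of a tent that lies at least \<open>t\<^sub>k\<close> generations deep is tested
  against \<open>\<sigma>\<close>: by Hoelder's inequality its \<open>\<sigma>\<close>-measure decays like \<open>\<rho>\<^sup>t\<^sup>/\<^sup>r\<^sup>'\<close>, so these costs
  are summable, while the shallow parts overlap at most \<open>t\<^sub>k\<close> times and contribute only
  \<open>\<Sum>\<^sub>k 2\<^sup>-\<^sup>k t\<^sub>k \<le> 1/2\<close> to the sum at any point.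

  The weight enters at the end. The reverse Hoelder characteristic replaces \<open>\<langle>\<sigma>\<^sup>r\<rangle>\<^sub>K\<^sup>1\<^sup>/\<^sup>r\<close> by
  \<open>\<langle>\<sigma>\<rangle>\<^sub>K\<close>, and \<open>|u| \<langle>\<sigma>\<rangle>\<^sub>K\<close> is at most the \<open>uB\<^sub>1\<close> characteristic times \<open>\<sigma>\<close> almost everywhere on
  \<open>K\<close>; so with \<open>g = |u f|\<close> the integral above is bounded by the product of the two
  characteristics and the norm of \<open>f\<close> in \<open>L\<^sup>1\<^sub>\<sigma>\<close>. If \<open>u\<close> vanishes almost everywhere the operator is
  zero, and otherwise \<open>\<sigma>\<close> is integrable with essentially bounded inverse, which excludes the
  degenerate values of the characteristics and makes the defining integral of \<open>T f\<close> converge.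
\<close>

section \<open>A weak-type inequality for averages over a sparse tree of sets\<close>

lemma dyadic_class:
  fixes x :: real
  assumes "0 < x" "x \<le> 1"
  shows "\<exists>k. (1/2) ^ Suc k < x \<and> x \<le> (1/2) ^ k"
proof -
  obtain m where m: "(1/2) ^ m < x" using real_arch_pow_inv[of x "1/2"] assms by auto
  define l where "l = (LEAST m. (1/2) ^ m < x)"
  have l: "(1/2) ^ l < x" unfolding l_def by (rule LeastI[of _ m]) (rule m)
  have "l \<noteq> 0" using l assms by (cases l) auto
  then obtain k where k: "l = Suc k" by (cases l) auto
  have "\<not> (1/2) ^ k < x" using not_less_Least[of k "\<lambda>m. (1/2) ^ m < x"] k by (auto simp: l_def)
  then show ?thesis using l k by auto
qed

text \<open>The cut-off depth of class \<open>k\<close> will be proportional to \<open>k + 1 - k0\<close> in truncated subtraction, so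
  that the classes below \<open>k0\<close> have depth 0 and the others are cut ever deeper. This lemma bounds the
  overlap that the cut-off permits, and \<open>sum_decay\<close> the total cost of what it leaves.\<close>
lemma sum_overlaps: "(\<Sum>k<K. (1/2) ^ k * real (k + 1 - k0)) \<le> 4 * (1/2) ^ k0"
proof -
  have 0: "(\<Sum>k<K. (1/2) ^ k * real (k + 1 - k0)) = 0" if "K \<le> k0" for K
    using that by (intro sum.neutral) auto
  have 1: "(\<Sum>k<k0 + n. (1/2) ^ k * real (k + 1 - k0)) = 4 * (1/2) ^ k0 - (2 * n + 4) * (1/2) ^ (k0 + n)" for n
  proof (induction n)
    case (Suc n)
    have "(\<Sum>k<k0 + Suc n. (1/2) ^ k * real (k + 1 - k0))
        = (\<Sum>k<k0 + n. (1/2) ^ k * real (k + 1 - k0)) + (1/2) ^ (k0 + n) * (n + 1)"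
      by simp
    also have "\<dots> = 4 * (1/2) ^ k0 - (2 * real (Suc n) + 4) * (1/2) ^ (k0 + Suc n)"
      unfolding Suc.IH by (simp add: algebra_simps)
    finally show ?case .
  qed (simp add: 0)
  show ?thesis
  proof (cases "K \<le> k0")
    case False
    then obtain n where "K = k0 + n" by (metis le_iff_add nat_le_linear)
    then show ?thesis using 1[of n] by simp
  qed (use 0 in simp)
qed

lemma sum_decay: "(\<Sum>k<K. (1/2::real) ^ (k + 1 - k0)) \<le> k0 + 1"
proof -
  have 0: "(\<Sum>k<K. (1/2::real) ^ (k + 1 - k0)) = K" if "K \<le> k0" for K
    using that by (simp add: sum.cong[of "{..<K}" "{..<K}" _ "\<lambda>_. 1"])
  have 1: "(\<Sum>k<k0 + n. (1/2::real) ^ (k + 1 - k0)) = k0 + 1 - (1/2) ^ n" for n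
    by (induction n) (auto simp: 0)
  show ?thesis
  proof (cases "K \<le> k0")
    case False
    then obtain n where "K = k0 + n" by (metis le_iff_add nat_le_linear)
    then show ?thesis using 1[of n] by simp
  qed (use 0 in simp)
qed

text \<open>Sets ordered by generation as in a martingale filtration. The last axiom is the source of all
  decay: the tents of the next generation leave a fixed proportion of each tent uncovered.\<close>
locale tent_tree =
  fixes M :: "'a measure" and I :: "'i set" and T :: "'i \<Rightarrow> 'a set"
    and gen :: "'i \<Rightarrow> nat" and \<rho> :: real
  assumes countable_I: "countable I"
    and tent_sets [measurable]: "i \<in> I \<Longrightarrow> T i \<in> sets M"
    and tent_pos: "i \<in> I \<Longrightarrow> emeasure M (T i) \<noteq> 0"
    and tent_fin: "i \<in> I \<Longrightarrow> emeasure M (T i) \<noteq> \<infinity>"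
    and nested: "\<lbrakk>i \<in> I; j \<in> I; gen i \<le> gen j; T i \<inter> T j \<noteq> {}\<rbrakk> \<Longrightarrow> T j \<subseteq> T i"
    and same_gen: "\<lbrakk>i \<in> I; j \<in> I; gen i = gen j; T i \<inter> T j \<noteq> {}\<rbrakk> \<Longrightarrow> i = j"
    and parent: "\<lbrakk>j \<in> I; gen j = Suc k\<rbrakk> \<Longrightarrow> \<exists>i\<in>I. gen i = k \<and> T j \<subseteq> T i"
    and rho: "0 < \<rho>" "\<rho> < 1"
    and sparse: "i \<in> I \<Longrightarrow>
      emeasure M (T i \<inter> (\<Union>j\<in>{j\<in>I. gen j = Suc (gen i)}. T j)) \<le> ennreal \<rho> * emeasure M (T i)"
begin

definition level :: "nat \<Rightarrow> 'a set" where
  "level k = (\<Union>j\<in>{j\<in>I. gen j = k}. T j)"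

lemma level_sets [measurable]: "level k \<in> sets M"
  unfolding level_def
  by (intro sets.countable_UN' countable_subset[OF _ countable_I]) auto

lemma level_Suc_subset: "level (Suc k) \<subseteq> level k"
  using parent unfolding level_def by blast

lemma level_antimono: "k \<le> l \<Longrightarrow> level l \<subseteq> level k"
  using level_Suc_subset lift_Suc_antimono_le[of level] by blast

text \<open>The generations are well-ordered, so among the tents of \<open>J\<close> that contain a given point there is
  one of least generation, and this one is not met by any earlier tent of \<open>J\<close>.\<close>
lemma maximal_tents:
  assumes J: "J \<subseteq> I"
  obtains J' where "J' \<subseteq> J" "disjoint_family_on T J'" "(\<Union>i\<in>J'. T i) = (\<Union>i\<in>J. T i)"
proof
  let ?J' = "{i\<in>J. \<forall>j\<in>J. gen j < gen i \<longrightarrow> T j \<inter> T i = {}}"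
  show "?J' \<subseteq> J" by auto
  show "disjoint_family_on T ?J'"
  proof (unfold disjoint_family_on_def, intro ballI impI)
    fix i j assume ij: "i \<in> ?J'" "j \<in> ?J'" "i \<noteq> j"
    consider "gen i < gen j" | "gen j < gen i" | "gen i = gen j" by linarith
    then show "T i \<inter> T j = {}"
      using ij same_gen[of i j] J by cases blast+
  qed
  have "\<exists>i\<in>?J'. x \<in> T i" if x: "i \<in> J" "x \<in> T i" for x i
  proof -
    define P where "P = (\<lambda>n. \<exists>i\<in>J. gen i = n \<and> x \<in> T i)"
    have "P (gen i)" using x by (auto simp: P_def)
    then have "P (LEAST n. P n)" by (rule LeastI)
    then obtain i0 where i0: "i0 \<in> J" "gen i0 = (LEAST n. P n)" "x \<in> T i0"
      by (auto simp: P_def)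
    have "T j \<inter> T i0 = {}" if j: "j \<in> J" "gen j < gen i0" for j
    proof (rule ccontr)
      assume "T j \<inter> T i0 \<noteq> {}"
      then have "T i0 \<subseteq> T j" using nested[of j i0] i0 j J by auto
      then have "P (gen j)" using i0 j by (auto simp: P_def)
      then show False using j i0 not_less_Least by metis
    qed
    then show ?thesis using i0 by blast
  qed
  then show "(\<Union>i\<in>?J'. T i) = (\<Union>i\<in>J. T i)" by blast
qed

lemma nn_integral_disjoint_UN:
  assumes "countable J" "\<And>i. i \<in> J \<Longrightarrow> E i \<in> sets M" "disjoint_family_on E J"
    and f [measurable]: "f \<in> borel_measurable M"
  shows "(\<integral>\<^sup>+x\<in>(\<Union>i\<in>J. E i). f x \<partial>M) = (\<integral>\<^sup>+i. (\<integral>\<^sup>+x\<in>E i. f x \<partial>M) \<partial>count_space J)"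
proof -
  have U: "(\<Union>i\<in>J. E i) \<in> sets M" using assms by (intro sets.countable_UN') auto
  have "(\<integral>\<^sup>+x\<in>(\<Union>i\<in>J. E i). f x \<partial>M) = emeasure (density M f) (\<Union>i\<in>J. E i)"
    using U by (simp add: emeasure_density)
  also have "\<dots> = (\<integral>\<^sup>+i. emeasure (density M f) (E i) \<partial>count_space J)"
    using assms by (intro emeasure_UN_countable) auto
  also have "\<dots> = (\<integral>\<^sup>+i. (\<integral>\<^sup>+x\<in>E i. f x \<partial>M) \<partial>count_space J)"
    using assms by (intro nn_integral_cong) (auto simp: emeasure_density)
  finally show ?thesis .
qed

text \<open>The tents of \<open>J\<close> may overlap, but the maximal ones are disjoint and have the same union.\<close>
lemma integral_Union_le:
  assumes J: "J \<subseteq> I"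
    and [measurable]: "f \<in> borel_measurable M" "h \<in> borel_measurable M"
    and le: "\<And>i. i \<in> J \<Longrightarrow> (\<integral>\<^sup>+x\<in>T i. f x \<partial>M) \<le> (\<integral>\<^sup>+x\<in>T i. h x \<partial>M)"
  shows "(\<integral>\<^sup>+x\<in>(\<Union>i\<in>J. T i). f x \<partial>M) \<le> (\<integral>\<^sup>+x\<in>(\<Union>i\<in>J. T i). h x \<partial>M)"
proof -
  obtain J' where J': "J' \<subseteq> J" "disjoint_family_on T J'" "(\<Union>i\<in>J'. T i) = (\<Union>i\<in>J. T i)"
    using maximal_tents[OF J] .
  have c: "countable J'" using J J' by (intro countable_subset[OF _ countable_I]) auto
  show ?thesis
    unfolding J'(3)[symmetric] using J J' c
    by (subst (1 2) nn_integral_disjoint_UN) (auto intro!: nn_integral_mono le)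
qed

lemma set_nn_integral_indicator:
  assumes "A \<in> sets M" "B \<in> sets M"
  shows "(\<integral>\<^sup>+x\<in>A. indicator B x \<partial>M) = emeasure M (A \<inter> B)"
proof -
  have "(\<integral>\<^sup>+x\<in>A. indicator B x \<partial>M) = (\<integral>\<^sup>+x. indicator (A \<inter> B) x \<partial>M)"
    by (intro nn_integral_cong) (auto split: split_indicator)
  then show ?thesis using assms by simp
qed

text \<open>Iteration of the sparseness axiom along the tents of generation \<open>gen i + t\<close>, which is legitimate
  because each \<open>level\<close> contains the next.\<close>
lemma level_decay:
  assumes i: "i \<in> I"
  shows "emeasure M (T i \<inter> level (gen i + t)) \<le> ennreal (\<rho> ^ t) * emeasure M (T i)"
proof (induction t)
  case 0
  show ?case using i by (auto intro!: emeasure_mono)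
next
  case (Suc t)
  let ?J = "{j\<in>I. gen j = gen i + t \<and> T j \<subseteq> T i}"
  let ?f = "indicator (level (gen i + Suc t)) :: 'a \<Rightarrow> ennreal"
  let ?U = "\<Union>j\<in>?J. T j"
  have U [measurable]: "?U \<in> sets M"
    by (intro sets.countable_UN' countable_subset[OF _ countable_I]) auto
  have eq: "?U = T i \<inter> level (gen i + t)"
    using nested[OF i] i unfolding level_def by fastforce
  have "(\<integral>\<^sup>+x\<in>T j. ?f x \<partial>M) \<le> (\<integral>\<^sup>+x\<in>T j. ennreal \<rho> \<partial>M)" if j: "j \<in> ?J" for j
  proof -
    have [measurable]: "T j \<in> sets M" using j by auto
    have "(\<integral>\<^sup>+x\<in>T j. ?f x \<partial>M) = emeasure M (T j \<inter> level (Suc (gen j)))"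
      using j by (subst set_nn_integral_indicator) auto
    also have "\<dots> \<le> ennreal \<rho> * emeasure M (T j)"
      using sparse[of j] j by (auto simp: level_def)
    finally show ?thesis by (simp add: nn_integral_cmult_indicator)
  qed
  then have le: "(\<integral>\<^sup>+x\<in>?U. ?f x \<partial>M) \<le> (\<integral>\<^sup>+x\<in>?U. ennreal \<rho> \<partial>M)"
    by (intro integral_Union_le) auto
  have "(\<integral>\<^sup>+x\<in>?U. ?f x \<partial>M) = emeasure M (T i \<inter> level (gen i + Suc t))"
    using level_Suc_subset[of "gen i + t"] U
    by (subst set_nn_integral_indicator) (auto simp: eq intro!: arg_cong[where f = "emeasure M"])
  with le have "emeasure M (T i \<inter> level (gen i + Suc t)) \<le> ennreal \<rho> * emeasure M (T i \<inter> level (gen i + t))"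
    using U by (simp add: nn_integral_cmult_indicator eq)
  also have "\<dots> \<le> ennreal \<rho> * (ennreal (\<rho> ^ t) * emeasure M (T i))"
    by (intro mult_left_mono Suc.IH) auto
  also have "\<dots> = ennreal (\<rho> ^ Suc t) * emeasure M (T i)"
    using rho by (simp add: ennreal_mult mult.assoc)
  finally show ?case .
qed

text \<open>The tents that contain \<open>x\<close> have distinct generations, and if \<open>m\<close> is the least of these then
  \<open>x\<close> lies in no tent of generation \<open>m + t\<close>.\<close>
lemma few_generations:
  assumes x: "finite J" "J \<subseteq> I" and xT: "\<And>i. i \<in> J \<Longrightarrow> x \<in> T i"
    and xn: "\<And>i. i \<in> J \<Longrightarrow> x \<notin> level (gen i + t)"
  shows "card J \<le> t"
proof (cases "J = {}")
  case False
  have inj: "inj_on gen J"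
  proof (rule inj_onI)
    fix i j assume ij: "i \<in> J" "j \<in> J" "gen i = gen j"
    then have "x \<in> T i" "x \<in> T j" using xT by auto
    then have "T i \<inter> T j \<noteq> {}" by auto
    then show "i = j" using ij x(2) same_gen[of i j] by auto
  qed
  define m where "m = Min (gen ` J)"
  have "m \<in> gen ` J" using x(1) False by (simp add: m_def)
  then obtain i0 where i0: "i0 \<in> J" "gen i0 = m" by auto
  have nm: "x \<notin> level (m + t)" using xn[OF i0(1)] i0(2) by simp
  have "gen i \<in> {m..<m + t}" if i: "i \<in> J" for i
  proof -
    have "x \<in> level (gen i)" using i x(2) xT[OF i] by (auto simp: level_def)
    then have "gen i < m + t" using level_antimono[of "m + t" "gen i"] nm by (meson not_le subsetD)
    moreover have "m \<le> gen i" using i x(1) by (simp add: m_def)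
    ultimately show ?thesis by simp
  qed
  then have "gen ` J \<subseteq> {m..<m + t}" by blast
  then have "card (gen ` J) \<le> card {m..<m+t}" by (intro card_mono) auto
  then show ?thesis using inj by (simp add: card_image)
qed auto

definition mean :: "('a \<Rightarrow> ennreal) \<Rightarrow> 'i \<Rightarrow> ennreal" where
  "mean g i = (\<integral>\<^sup>+x\<in>T i. g x \<partial>M) / emeasure M (T i)"

lemma mean_times: "i \<in> I \<Longrightarrow> mean g i * emeasure M (T i) = (\<integral>\<^sup>+x\<in>T i. g x \<partial>M)"
  using tent_pos[of i] tent_fin[of i]
  by (simp add: mean_def ennreal_divide_times ennreal_times_divide[symmetric] ennreal_divide_self less_top)

text \<open>A Carleson embedding. The averages of \<open>g\<close> over the tents of \<open>J\<close> agree up to a factor 2, and the tents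
  of \<open>J\<close> strictly inside \<open>T i\<close> start \<open>N\<close> generations later, so that they cover at most a quarter of it.
  Hence they carry at most half of the integral of \<open>g\<close> over \<open>T i\<close>. At least the other half lives
  on \<open>T i - D i\<close>, and these sets are disjoint.\<close>
lemma residue_class_sum:
  assumes J: "finite J" "J \<subseteq> I"
    and res: "\<And>i j. i \<in> J \<Longrightarrow> j \<in> J \<Longrightarrow> gen i < gen j \<Longrightarrow> gen i + N \<le> gen j"
    and N: "\<rho> ^ N \<le> 1/4"
    and \<beta>: "\<And>i. i \<in> J \<Longrightarrow> mean g i \<le> ennreal \<beta>" "\<And>i. i \<in> J \<Longrightarrow> ennreal (\<beta>/2) \<le> mean g i" "0 < \<beta>"
    and g [measurable]: "g \<in> borel_measurable M" "G \<in> borel_measurable M"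
    and dom: "\<And>i. i \<in> I \<Longrightarrow> AE x in M. x \<in> T i \<longrightarrow> a i * g x \<le> G x"
  shows "(\<Sum>i\<in>J. a i * (\<integral>\<^sup>+x\<in>T i. g x \<partial>M)) \<le> 2 * (\<integral>\<^sup>+x. G x \<partial>M)"
proof -
  define D where "D i = (\<Union>j\<in>{j\<in>J. gen i < gen j \<and> T j \<subseteq> T i}. T j)" for i
  have D [measurable]: "D i \<in> sets M" for i
    unfolding D_def using J by (intro sets.finite_UN) auto
  have DT: "D i \<subseteq> T i" for i by (auto simp: D_def)
  have half: "(\<integral>\<^sup>+x\<in>T i. g x \<partial>M) \<le> 2 * (\<integral>\<^sup>+x\<in>T i - D i. g x \<partial>M)" if i: "i \<in> J" for i
  proof -
    have iI: "i \<in> I" and [measurable]: "T i \<in> sets M" using i J by auto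
    have le: "(\<integral>\<^sup>+x\<in>T j. g x \<partial>M) \<le> (\<integral>\<^sup>+x\<in>T j. ennreal \<beta> \<partial>M)" if "j \<in> J" for j
    proof -
      have "j \<in> I" using that J by auto
      then have "(\<integral>\<^sup>+x\<in>T j. g x \<partial>M) = mean g j * emeasure M (T j)" by (simp add: mean_times)
      also have "\<dots> \<le> ennreal \<beta> * emeasure M (T j)" by (intro mult_right_mono \<beta> that) auto
      finally show ?thesis using \<open>j \<in> I\<close> by (simp add: nn_integral_cmult_indicator)
    qed
    have "(\<integral>\<^sup>+x\<in>D i. g x \<partial>M) \<le> (\<integral>\<^sup>+x\<in>D i. ennreal \<beta> \<partial>M)"
      unfolding D_def using J by (intro integral_Union_le le) auto
    also have "\<dots> = ennreal \<beta> * emeasure M (D i)" by (simp add: nn_integral_cmult_indicator)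
    also have "\<dots> \<le> ennreal \<beta> * emeasure M (T i \<inter> level (gen i + N))"
    proof (intro mult_left_mono emeasure_mono)
      have "T j \<subseteq> level (gen i + N)" if "j \<in> J" "gen i < gen j" for j
        using res[OF i that] level_antimono[of "gen i + N" "gen j"] that J
        unfolding level_def by blast
      then show "D i \<subseteq> T i \<inter> level (gen i + N)" by (auto simp: D_def)
    qed auto
    also have "\<dots> \<le> ennreal \<beta> * (ennreal (\<rho>^N) * emeasure M (T i))"
      by (intro mult_left_mono level_decay iI) auto
    also have "\<dots> \<le> ennreal \<beta> * (ennreal (1/4) * emeasure M (T i))"
      using N by (intro mult_left_mono mult_right_mono ennreal_leI) auto
    also have "\<dots> = ennreal (1/2) * (ennreal (\<beta>/2) * emeasure M (T i))"
    proof -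
      have "ennreal \<beta> * ennreal (1/4) = ennreal (1/2) * ennreal (\<beta>/2)"
        using \<beta>(3) by (subst (1 2) ennreal_mult[symmetric]) auto
      then show ?thesis by (simp only: mult.assoc[symmetric])
    qed
    also have "\<dots> \<le> ennreal (1/2) * (mean g i * emeasure M (T i))"
      by (intro mult_left_mono mult_right_mono \<beta> i) auto
    also have "\<dots> = ennreal (1/2) * (\<integral>\<^sup>+x\<in>T i. g x \<partial>M)" by (simp add: mean_times iI)
    finally have small: "(\<integral>\<^sup>+x\<in>D i. g x \<partial>M) \<le> ennreal (1/2) * (\<integral>\<^sup>+x\<in>T i. g x \<partial>M)" .
    have split: "(\<integral>\<^sup>+x\<in>T i. g x \<partial>M) = (\<integral>\<^sup>+x\<in>T i - D i. g x \<partial>M) + (\<integral>\<^sup>+x\<in>D i. g x \<partial>M)"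
      using DT[of i]
      by (subst nn_integral_add[symmetric]) (auto intro!: nn_integral_cong split: split_indicator)
    have "(\<integral>\<^sup>+x\<in>T i. g x \<partial>M) \<le> ennreal \<beta> * emeasure M (T i)"
      using le[OF i] iI by (simp add: nn_integral_cmult_indicator)
    also have "\<dots> < \<infinity>" using tent_fin[OF iI] by (simp add: ennreal_mult_less_top less_top)
    finally obtain t where t: "(\<integral>\<^sup>+x\<in>T i. g x \<partial>M) = ennreal t" "0 \<le> t"
      by (cases "\<integral>\<^sup>+x\<in>T i. g x \<partial>M") auto
    obtain d where d: "(\<integral>\<^sup>+x\<in>D i. g x \<partial>M) = ennreal d" "0 \<le> d"
      using split t by (cases "\<integral>\<^sup>+x\<in>D i. g x \<partial>M") (auto simp: top_unique)
    obtain e where e: "(\<integral>\<^sup>+x\<in>T i - D i. g x \<partial>M) = ennreal e" "0 \<le> e"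
      using split t by (cases "\<integral>\<^sup>+x\<in>T i - D i. g x \<partial>M") (auto simp: top_unique)
    have "d \<le> 1/2 * t" using small t d by (simp add: ennreal_mult[symmetric] del: ennreal_half)
    moreover have "t = e + d" using split t d e by (simp add: ennreal_plus[symmetric] del: ennreal_plus)
    ultimately have "ennreal t \<le> ennreal (2 * e)" by (intro ennreal_leI) simp
    then show ?thesis using t(1) e by (simp add: ennreal_mult)
  qed
  have disj: "disjoint_family_on (\<lambda>i. T i - D i) J"
  proof (unfold disjoint_family_on_def, intro ballI impI)
    have *: "(T i - D i) \<inter> T j = {}" if "i \<in> J" "j \<in> J" "i \<noteq> j" "gen i \<le> gen j" for i j
    proof (rule ccontr)
      assume ne: "(T i - D i) \<inter> T j \<noteq> {}"
      then have m: "T i \<inter> T j \<noteq> {}" by auto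
      then have "T j \<subseteq> T i" "gen i \<noteq> gen j" using nested[of i j] same_gen[of i j] that J by auto
      then have "T j \<subseteq> D i" using that by (auto simp: D_def)
      then show False using ne by auto
    qed
    fix i j assume "i \<in> J" "j \<in> J" "i \<noteq> j"
    then show "(T i - D i) \<inter> (T j - D j) = {}" using *[of i j] *[of j i]
      by (cases "gen i \<le> gen j") auto
  qed
  have "(\<Sum>i\<in>J. a i * (\<integral>\<^sup>+x\<in>T i. g x \<partial>M)) \<le> (\<Sum>i\<in>J. 2 * (\<integral>\<^sup>+x\<in>T i - D i. G x \<partial>M))"
  proof (rule sum_mono)
    fix i assume i: "i \<in> J"
    then have iI: "i \<in> I" and [measurable]: "T i \<in> sets M" using J by auto
    have "a i * (\<integral>\<^sup>+x\<in>T i. g x \<partial>M) \<le> a i * (2 * (\<integral>\<^sup>+x\<in>T i - D i. g x \<partial>M))"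
      by (intro mult_left_mono half i) auto
    also have "\<dots> = 2 * (\<integral>\<^sup>+x. a i * (g x * indicator (T i - D i) x) \<partial>M)"
      by (subst nn_integral_cmult) (auto simp: ac_simps)
    also have "\<dots> \<le> 2 * (\<integral>\<^sup>+x\<in>T i - D i. G x \<partial>M)"
      using dom[OF iI] by (intro mult_left_mono nn_integral_mono_AE) (auto split: split_indicator)
    finally show "a i * (\<integral>\<^sup>+x\<in>T i. g x \<partial>M) \<le> 2 * (\<integral>\<^sup>+x\<in>T i - D i. G x \<partial>M)" .
  qed
  also have "\<dots> = 2 * (\<integral>\<^sup>+x\<in>(\<Union>i\<in>J. T i - D i). G x \<partial>M)"
    using J disj
    by (subst nn_integral_disjoint_UN)
       (auto simp: sum_distrib_left nn_integral_count_space_finite intro: countable_finite)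
  also have "\<dots> \<le> 2 * (\<integral>\<^sup>+x. G x \<partial>M)"
    by (intro mult_left_mono nn_integral_mono) (auto split: split_indicator)
  finally show ?thesis .
qed

text \<open>The generation gap needed in \<open>residue_class_sum\<close> is obtained by sorting the tents according to their
  generation modulo \<open>N\<close>.\<close>
lemma class_sum:
  assumes J: "finite J" "J \<subseteq> I" and N: "\<rho> ^ N \<le> 1/4"
    and \<beta>: "\<And>i. i \<in> J \<Longrightarrow> mean g i \<le> ennreal \<beta>" "\<And>i. i \<in> J \<Longrightarrow> ennreal (\<beta>/2) \<le> mean g i" "0 < \<beta>"
    and g [measurable]: "g \<in> borel_measurable M" "G \<in> borel_measurable M"
    and dom: "\<And>i. i \<in> I \<Longrightarrow> AE x in M. x \<in> T i \<longrightarrow> a i * g x \<le> G x"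
  shows "(\<Sum>i\<in>J. a i * (\<integral>\<^sup>+x\<in>T i. g x \<partial>M)) \<le> of_nat (2 * N) * (\<integral>\<^sup>+x. G x \<partial>M)"
proof -
  have "N \<noteq> 0" using N by (cases N) auto
  then have sub: "(\<lambda>i. gen i mod N) ` J \<subseteq> {..<N}" by auto
  have "(\<Sum>i\<in>J. a i * (\<integral>\<^sup>+x\<in>T i. g x \<partial>M))
      = (\<Sum>m<N. \<Sum>i\<in>{i\<in>J. gen i mod N = m}. a i * (\<integral>\<^sup>+x\<in>T i. g x \<partial>M))"
    using J sub by (subst sum.group) auto
  also have "\<dots> \<le> (\<Sum>m<N. 2 * (\<integral>\<^sup>+x. G x \<partial>M))"
  proof (rule sum_mono)
    fix m
    show "(\<Sum>i\<in>{i\<in>J. gen i mod N = m}. a i * (\<integral>\<^sup>+x\<in>T i. g x \<partial>M)) \<le> 2 * (\<integral>\<^sup>+x. G x \<partial>M)"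
    proof (rule residue_class_sum[where N = N and \<beta> = \<beta>])
      fix i j assume "i \<in> {i\<in>J. gen i mod N = m}" "j \<in> {i\<in>J. gen i mod N = m}" and lt: "gen i < gen j"
      then have "N dvd gen j - gen i" using mod_eq_dvd_iff_nat[of "gen i" "gen j" N] by auto
      then have "N \<le> gen j - gen i" using lt by (intro dvd_imp_le) auto
      then show "gen i + N \<le> gen j" using lt by simp
    qed (use J \<beta> N dom in auto)
  qed
  also have "\<dots> = of_nat (2 * N) * (\<integral>\<^sup>+x. G x \<partial>M)" by (simp add: mult_ac)
  finally show ?thesis .
qed

text \<open>The number \<open>a i\<close> is the Hoelder constant of \<open>s\<close> on \<open>T i\<close> with dual exponent \<open>p\<close>; it stands for a
  multiple of \<open>\<langle>s\<^sup>r\<rangle>\<^sup>1\<^sup>/\<^sup>r\<close>. The function \<open>G\<close> dominates \<open>g\<close> times the maximal function built from the \<open>a i\<close>.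
  Points in a tent with average above 1 are handled by the maximal such tents. Elsewhere, removing
  from each tent the part that is not \<open>deep\<close> lowers the sum by at most \<open>1/2\<close>, so that it remains to
  integrate the deep part \<open>H\<close> against \<open>s\<close>.\<close>
lemma weak_type_finite:
  assumes J: "finite J" "J \<subseteq> I" and N: "\<rho> ^ N \<le> 1/2" and p: "1 \<le> p"
    and meas [measurable]: "g \<in> borel_measurable M" "s \<in> borel_measurable M" "G \<in> borel_measurable M"
    and holder: "\<And>i E q. \<lbrakk>i \<in> I; E \<in> sets M; E \<subseteq> T i; 0 < q; emeasure M E \<le> ennreal q * emeasure M (T i)\<rbrakk>
        \<Longrightarrow> (\<integral>\<^sup>+x\<in>E. s x \<partial>M) \<le> a i * emeasure M (T i) * ennreal (q powr (1/p))"
    and dom: "\<And>i. i \<in> I \<Longrightarrow> AE x in M. x \<in> T i \<longrightarrow> a i * g x \<le> G x"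
  shows "(\<integral>\<^sup>+x\<in>{x\<in>space M. 1 < (\<Sum>i\<in>J. mean g i * indicator (T i) x)}. s x \<partial>M)
    \<le> ennreal ((1 + 8 * real N * (6 + real N)) * (1 + ln p)) * (\<integral>\<^sup>+x. G x \<partial>M)"
proof -
  \<comment> \<open>The depth unit \<open>L\<close> gains a factor \<open>1/2\<close> in Hoelder's inequality, that is
    \<open>\<rho>\<^sup>L\<^sup>/\<^sup>p \<le> 1/2\<close>. The class \<open>k0\<close> comes so late that \<open>2\<^sup>k\<^sup>0 \<ge> 8 L\<close>; this is all that the overlap bound
    needs, and it costs only a logarithm of \<open>p\<close>.\<close>
  define k0 where "k0 = 4 + N + nat \<lceil>log 2 p\<rceil>"
  define L where "L = N * nat \<lceil>p\<rceil>"
  define J1 where "J1 = {i\<in>J. 0 < mean g i \<and> mean g i \<le> 1}"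
  have J1: "finite J1" "J1 \<subseteq> I" using J by (auto simp: J1_def)
  have "\<exists>k. ennreal ((1/2) ^ Suc k) \<le> mean g i \<and> mean g i \<le> ennreal ((1/2) ^ k)" if "i \<in> J1" for i
  proof -
    have "mean g i < top"
      using that by (auto simp: J1_def intro: le_less_trans[OF _ ennreal_one_less_top])
    then obtain v where v: "mean g i = ennreal v" "0 \<le> v" by (cases "mean g i") auto
    moreover have "0 < v" "v \<le> 1" using that v by (auto simp: J1_def)
    ultimately show ?thesis using dyadic_class[of v] by (force intro!: ennreal_leI simp del: power_Suc)
  qed
  then obtain \<kappa> where \<kappa>: "\<And>i. i \<in> J1 \<Longrightarrow> ennreal ((1/2) ^ Suc (\<kappa> i)) \<le> mean g i"
      "\<And>i. i \<in> J1 \<Longrightarrow> mean g i \<le> ennreal ((1/2) ^ \<kappa> i)" by metis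
  define K where "K = Suc (Max (\<kappa> ` J1))"
  have K: "\<kappa> i < K" if "i \<in> J1" for i
    using that J1 by (auto simp: K_def less_Suc_eq_le)
  define t where "t k = L * (k + 1 - k0)" for k
  define deep where "deep i = T i \<inter> level (gen i + t (\<kappa> i))" for i
  have deep_sets [measurable]: "deep i \<in> sets M" if "i \<in> I" for i using that by (auto simp: deep_def)
  define \<Omega> where "\<Omega> = (\<Union>i\<in>{i\<in>I. 1 < mean g i}. T i)"
  have \<Omega> [measurable]: "\<Omega> \<in> sets M"
    unfolding \<Omega>_def by (intro sets.countable_UN' countable_subset[OF _ countable_I]) auto
  define H where "H x = (\<Sum>i\<in>J1. mean g i * indicator (deep i) x)" for x
  have H [measurable]: "H \<in> borel_measurable M"
    unfolding H_def using J1 by (intro borel_measurable_sum) auto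

  have p_ceil: "p \<le> real (nat \<lceil>p\<rceil>)" "real (nat \<lceil>p\<rceil>) \<le> 2 * p" using p by linarith+
  have k0_ge: "8 * real L \<le> 2 ^ k0"
  proof -
    have "real L \<le> 2 ^ N * (2 * p)"
      unfolding L_def of_nat_mult using p_ceil by (intro mult_mono) (auto simp: of_nat_less_two_power less_imp_le)
    also have "p \<le> 2 ^ nat \<lceil>log 2 p\<rceil>"
    proof -
      have "p = 2 powr (log 2 p)" using p by simp
      also have "\<dots> \<le> 2 powr (real (nat \<lceil>log 2 p\<rceil>))" by (intro powr_mono) (auto simp: real_nat_ceiling_ge)
      finally show ?thesis by (simp add: powr_realpow)
    qed
    finally show ?thesis by (simp add: k0_def power_add)
  qed
  have k0_le: "real k0 + 1 \<le> (6 + N) * (1 + ln p)"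
  proof -
    have l0: "0 \<le> ln p" using p by simp
    have "ln p / ln 2 \<le> ln p / (1/2)" using l0 ln2_ge_two_thirds by (intro divide_left_mono) auto
    then have "log 2 p \<le> 2 * ln p" by (simp add: log_def)
    moreover have "real (nat \<lceil>log 2 p\<rceil>) \<le> log 2 p + 1" using p by (simp add: zero_le_log_cancel_iff)
    ultimately have "real k0 \<le> 5 + N + 2 * ln p" by (simp add: k0_def)
    also have "\<dots> + 1 \<le> (6 + N) * (1 + ln p)" using l0 by (simp add: algebra_simps)
    finally show ?thesis by simp
  qed

  \<comment> \<open>At a point, class \<open>k\<close> has at most \<open>t k\<close> shallow tents, each with average at most \<open>2\<^sup>-\<^sup>k\<close>.\<close>
  have shallow: "(\<Sum>i\<in>J1. mean g i * indicator (T i - deep i) x) \<le> ennreal (1/2)" for x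
  proof -
    define S where "S k = {i\<in>J1. \<kappa> i = k \<and> x \<in> T i - deep i}" for k
    have cardS: "card (S k) \<le> t k" for k
      using J1 by (intro few_generations[where x = x]) (auto simp: S_def deep_def)
    have "(\<Sum>i\<in>J1. mean g i * indicator (T i - deep i) x) =
        (\<Sum>k<K. \<Sum>i\<in>{i\<in>J1. \<kappa> i = k}. mean g i * indicator (T i - deep i) x)"
      using J1 K by (subst sum.group) auto
    also have "\<dots> = (\<Sum>k<K. \<Sum>i\<in>S k. mean g i)"
      using J1 by (intro sum.cong refl sum.mono_neutral_cong_right) (auto simp: S_def)
    also have "\<dots> \<le> (\<Sum>k<K. \<Sum>i\<in>S k. ennreal ((1/2) ^ k))"
      using \<kappa> by (intro sum_mono) (auto simp: S_def)
    also have "\<dots> = (\<Sum>k<K. ennreal (real (card (S k)) * (1/2) ^ k))"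
      by (simp add: ennreal_mult ennreal_of_nat_eq_real_of_nat)
    also have "\<dots> \<le> (\<Sum>k<K. ennreal (real (t k) * (1/2) ^ k))"
      using cardS by (intro sum_mono ennreal_leI mult_right_mono) auto
    also have "\<dots> = ennreal (\<Sum>k<K. real (t k) * (1/2) ^ k)"
      by (intro sum_ennreal) auto
    also have "\<dots> = ennreal (L * (\<Sum>k<K. (1/2) ^ k * real (k + 1 - k0)))"
      by (simp add: t_def sum_distrib_left mult_ac)
    also have "\<dots> \<le> ennreal (L * (4 * (1/2) ^ k0))"
      by (intro ennreal_leI mult_left_mono sum_overlaps) auto
    also have "\<dots> \<le> ennreal (1/2)"
      using k0_ge by (intro ennreal_leI) (simp add: field_simps)
    finally show ?thesis .
  qed

  have cover: "1 \<le> 2 * H x" if x: "1 < (\<Sum>i\<in>J. mean g i * indicator (T i) x)" "x \<notin> \<Omega>" for x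
  proof -
    have "(\<Sum>i\<in>J. mean g i * indicator (T i) x) = (\<Sum>i\<in>J1. mean g i * indicator (T i) x)"
    proof (rule sum.mono_neutral_right)
      show "\<forall>i\<in>J - J1. mean g i * indicator (T i) x = 0"
      proof
        fix i assume i: "i \<in> J - J1"
        then consider "mean g i = 0" | "1 < mean g i" by (auto simp: J1_def zero_less_iff_neq_zero not_le)
        then show "mean g i * indicator (T i) x = 0"
        proof cases
          case 2
          then have "x \<notin> T i" using i J x(2) by (auto simp: \<Omega>_def)
          then show ?thesis by simp
        qed simp
      qed
    qed (use J in \<open>auto simp: J1_def\<close>)
    also have "\<dots> = H x + (\<Sum>i\<in>J1. mean g i * indicator (T i - deep i) x)"
      unfolding H_def sum.distrib[symmetric]
      by (intro sum.cong refl) (auto simp: deep_def split: split_indicator)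
    also have "\<dots> \<le> H x + ennreal (1/2)" by (intro add_left_mono shallow)
    finally have lt: "1 < H x + ennreal (1/2)" using x(1) by (rule less_le_trans[rotated])
    show ?thesis
    proof (cases "H x")
      case (real h)
      have "ennreal 1 < ennreal (h + 1/2)" using lt real by (simp add: ennreal_plus[symmetric] del: ennreal_plus ennreal_half)
      then have "1 < h + 1/2" by (subst (asm) ennreal_less_iff) auto
      then have "ennreal 1 \<le> ennreal (2 * h)" by (intro ennreal_leI) auto
      then show ?thesis using real by (simp add: ennreal_mult)
    qed (simp add: ennreal_mult_top)
  qed

  have big: "(\<integral>\<^sup>+x\<in>\<Omega>. s x \<partial>M) \<le> (\<integral>\<^sup>+x. G x \<partial>M)"
  proof -
    have "(\<integral>\<^sup>+x\<in>\<Omega>. s x \<partial>M) \<le> (\<integral>\<^sup>+x\<in>\<Omega>. G x \<partial>M)"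
      unfolding \<Omega>_def
    proof (rule integral_Union_le)
      fix i assume "i \<in> {i\<in>I. 1 < mean g i}"
      then have i: "i \<in> I" "1 \<le> mean g i" and [measurable]: "T i \<in> sets M" by auto
      have "(\<integral>\<^sup>+x\<in>T i. s x \<partial>M) \<le> a i * emeasure M (T i)"
        using holder[of i "T i" 1] i by simp
      also have "\<dots> \<le> a i * (mean g i * emeasure M (T i))"
        using mult_right_mono[OF i(2), of "emeasure M (T i)"] by (intro mult_left_mono) auto
      also have "\<dots> = (\<integral>\<^sup>+x. a i * (g x * indicator (T i) x) \<partial>M)"
        using i by (simp add: mean_times nn_integral_cmult)
      also have "\<dots> \<le> (\<integral>\<^sup>+x\<in>T i. G x \<partial>M)"
        using dom[OF i(1)] by (intro nn_integral_mono_AE) (auto split: split_indicator)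
      finally show "(\<integral>\<^sup>+x\<in>T i. s x \<partial>M) \<le> (\<integral>\<^sup>+x\<in>T i. G x \<partial>M)" .
    qed auto
    also have "\<dots> \<le> (\<integral>\<^sup>+x. G x \<partial>M)" by (intro nn_integral_mono) (auto split: split_indicator)
    finally show ?thesis .
  qed

  \<comment> \<open>Exchanging the roles of \<open>g\<close> and \<open>s\<close> in the product of averages is what turns the Hoelder
    constant \<open>a i\<close> of \<open>s\<close> into a factor of the integral of \<open>g\<close>.\<close>
  have deep_term: "mean g i * (\<integral>\<^sup>+x\<in>deep i. s x \<partial>M)
      \<le> ennreal ((1/2) ^ (\<kappa> i + 1 - k0)) * (a i * (\<integral>\<^sup>+x\<in>T i. g x \<partial>M))" if i: "i \<in> I" for i
  proof -
    let ?m = "\<kappa> i + 1 - k0"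
    have "(\<rho> ^ t (\<kappa> i)) powr (1/p) \<le> (1/2) ^ ?m"
    proof -
      have "\<rho> ^ t (\<kappa> i) = (\<rho> ^ N) ^ (nat \<lceil>p\<rceil> * ?m)"
        by (simp add: t_def L_def power_mult[symmetric] mult_ac)
      also have "\<dots> \<le> (1/2) ^ (nat \<lceil>p\<rceil> * ?m)" using N rho by (intro power_mono) auto
      also have "\<dots> = (1/2) powr (real (nat \<lceil>p\<rceil>) * ?m)"
        by (subst powr_realpow[symmetric]) auto
      also have "\<dots> \<le> (1/2) powr (p * ?m)"
        using p_ceil(1) by (intro powr_mono' mult_right_mono) auto
      finally have "(\<rho> ^ t (\<kappa> i)) powr (1/p) \<le> ((1/2) powr (p * ?m)) powr (1/p)"
        using rho p by (intro powr_mono2) auto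
      also have "\<dots> = (1/2) powr real ?m" using p by (simp add: powr_powr)
      also have "\<dots> = (1/2) ^ ?m" by (subst powr_realpow) auto
      finally show ?thesis .
    qed
    then have q: "ennreal ((\<rho> ^ t (\<kappa> i)) powr (1/p)) \<le> ennreal ((1/2) ^ ?m)" by (rule ennreal_leI)
    have "(\<integral>\<^sup>+x\<in>deep i. s x \<partial>M) \<le> a i * emeasure M (T i) * ennreal ((\<rho> ^ t (\<kappa> i)) powr (1/p))"
      using i rho level_decay[OF i] by (intro holder) (auto simp: deep_def)
    also have "\<dots> \<le> a i * emeasure M (T i) * ennreal ((1/2) ^ ?m)"
      by (intro mult_left_mono q) auto
    finally have "mean g i * (\<integral>\<^sup>+x\<in>deep i. s x \<partial>M) \<le> mean g i * (a i * emeasure M (T i) * ennreal ((1/2) ^ ?m))"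
      by (intro mult_left_mono) auto
    also have "\<dots> = ennreal ((1/2) ^ ?m) * (a i * (mean g i * emeasure M (T i)))" by (simp only: mult_ac)
    finally show ?thesis using i by (simp only: mean_times)
  qed

  have deep: "(\<integral>\<^sup>+x. H x * s x \<partial>M) \<le> ennreal (4 * N * (k0 + 1)) * (\<integral>\<^sup>+x. G x \<partial>M)"
  proof -
    let ?I = "\<integral>\<^sup>+x. G x \<partial>M"
    have "(\<integral>\<^sup>+x. H x * s x \<partial>M) = (\<integral>\<^sup>+x. (\<Sum>i\<in>J1. mean g i * (s x * indicator (deep i) x)) \<partial>M)"
      unfolding H_def sum_distrib_right by (simp add: mult_ac)
    also have "\<dots> = (\<Sum>i\<in>J1. mean g i * (\<integral>\<^sup>+x\<in>deep i. s x \<partial>M))"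
      using J1 deep_sets by (subst nn_integral_sum) (auto simp: nn_integral_cmult intro!: sum.cong)
    also have "\<dots> \<le> (\<Sum>i\<in>J1. ennreal ((1/2) ^ (\<kappa> i + 1 - k0)) * (a i * (\<integral>\<^sup>+x\<in>T i. g x \<partial>M)))"
      using J1 by (intro sum_mono deep_term) auto
    also have "\<dots> = (\<Sum>k<K. \<Sum>i\<in>{i\<in>J1. \<kappa> i = k}. ennreal ((1/2) ^ (\<kappa> i + 1 - k0)) * (a i * (\<integral>\<^sup>+x\<in>T i. g x \<partial>M)))"
      using J1 K by (subst sum.group) auto
    also have "\<dots> = (\<Sum>k<K. ennreal ((1/2) ^ (k + 1 - k0)) * (\<Sum>i\<in>{i\<in>J1. \<kappa> i = k}. a i * (\<integral>\<^sup>+x\<in>T i. g x \<partial>M)))"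
      unfolding sum_distrib_left by (intro sum.cong refl) auto
    also have "\<dots> \<le> (\<Sum>k<K. ennreal ((1/2) ^ (k + 1 - k0)) * (of_nat (2 * (2 * N)) * ?I))"
    proof (intro sum_mono mult_left_mono)
      fix k
      have "\<rho> ^ (2 * N) \<le> (1/2)\<^sup>2"
        unfolding mult.commute[of 2 N] power_mult using N rho by (intro power_mono) auto
      then have N2: "\<rho> ^ (2 * N) \<le> 1/4" by (simp add: power2_eq_square)
      show "(\<Sum>i\<in>{i\<in>J1. \<kappa> i = k}. a i * (\<integral>\<^sup>+x\<in>T i. g x \<partial>M)) \<le> of_nat (2 * (2 * N)) * ?I"
        by (rule class_sum[where \<beta> = "(1/2) ^ k"]) (use J1 N2 dom \<kappa> in auto)
    qed auto
    also have "\<dots> = ennreal (\<Sum>k<K. (1/2) ^ (k + 1 - k0)) * (of_nat (2 * (2 * N)) * ?I)"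
      unfolding sum_distrib_right[symmetric] by (subst sum_ennreal) auto
    also have "\<dots> \<le> ennreal (k0 + 1) * (of_nat (2 * (2 * N)) * ?I)"
      by (intro mult_right_mono ennreal_leI sum_decay) auto
    also have "\<dots> = ennreal (4 * N * (k0 + 1)) * ?I"
      unfolding mult.assoc[symmetric] ennreal_of_nat_eq_real_of_nat
      by (subst ennreal_mult[symmetric]) (auto simp: mult_ac algebra_simps)
    finally show ?thesis .
  qed

  have "(\<integral>\<^sup>+x\<in>{x\<in>space M. 1 < (\<Sum>i\<in>J. mean g i * indicator (T i) x)}. s x \<partial>M)
      \<le> (\<integral>\<^sup>+x. s x * indicator \<Omega> x + 2 * (H x * s x) \<partial>M)"
  proof (intro nn_integral_mono)
    fix x
    show "s x * indicator {x\<in>space M. 1 < (\<Sum>i\<in>J. mean g i * indicator (T i) x)} x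
        \<le> s x * indicator \<Omega> x + 2 * (H x * s x)"
    proof (cases "x \<in> \<Omega> \<or> \<not> 1 < (\<Sum>i\<in>J. mean g i * indicator (T i) x)")
      case False
      then have "1 * s x \<le> (2 * H x) * s x" using cover[of x] by (intro mult_right_mono) auto
      then show ?thesis using False by (auto simp: mult.assoc split: split_indicator)
    qed (auto split: split_indicator)
  qed
  also have "\<dots> = (\<integral>\<^sup>+x\<in>\<Omega>. s x \<partial>M) + 2 * (\<integral>\<^sup>+x. H x * s x \<partial>M)"
    by (simp add: nn_integral_add nn_integral_cmult)
  also have "\<dots> \<le> (\<integral>\<^sup>+x. G x \<partial>M) + 2 * (ennreal (4 * N * (k0 + 1)) * (\<integral>\<^sup>+x. G x \<partial>M))"
    by (intro add_mono mult_left_mono big deep) auto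
  also have "\<dots> = ennreal (1 + 8 * N * (k0 + 1)) * (\<integral>\<^sup>+x. G x \<partial>M)"
  proof -
    have "ennreal (1 + 8 * N * (k0 + 1)) = 1 + 2 * ennreal (4 * N * (k0 + 1))"
    proof -
      have "real (1 + 8 * N * (k0 + 1)) = 1 + 2 * real (4 * N * (k0 + 1))" by simp
      then show ?thesis
        by (simp only:) (subst ennreal_plus, simp, simp, subst ennreal_mult, simp_all del: of_nat_mult of_nat_add)
    qed
    then show ?thesis by (simp add: distrib_right mult.assoc)
  qed
  also have "\<dots> \<le> ennreal ((1 + 8 * real N * (6 + real N)) * (1 + ln p)) * (\<integral>\<^sup>+x. G x \<partial>M)"
  proof (intro mult_right_mono ennreal_leI)
    have "8 * N * (real k0 + 1) \<le> 8 * N * ((6 + N) * (1 + ln p))"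
      by (intro mult_left_mono k0_le) auto
    moreover have "0 \<le> ln p" using p by simp
    ultimately show "real (1 + 8 * N * (k0 + 1)) \<le> (1 + 8 * real N * (6 + real N)) * (1 + ln p)"
      by (simp add: algebra_simps)
  qed auto
  finally show ?thesis .
qed


lemma finite_initial: "finite {i\<in>I. to_nat_on I i < n}"
proof (rule inj_on_finite[where f = "to_nat_on I" and B = "{..<n}"])
  show "inj_on (to_nat_on I) {i\<in>I. to_nat_on I i < n}"
    using inj_on_to_nat_on[OF countable_I] by (rule inj_on_subset) auto
qed auto

lemma count_space_eq_SUP:
  fixes f :: "'i \<Rightarrow> ennreal"
  shows "(\<integral>\<^sup>+i. f i \<partial>count_space I) = (SUP n. \<Sum>i\<in>{i\<in>I. to_nat_on I i < n}. f i)"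
proof -
  let ?I = "\<lambda>n. {i\<in>I. to_nat_on I i < n}"
  have "(\<integral>\<^sup>+i. f i \<partial>count_space I) = (\<integral>\<^sup>+i. (SUP n. f i * indicator (?I n) i) \<partial>count_space I)"
  proof (intro nn_integral_cong)
    fix i assume "i \<in> space (count_space I)"
    then have i: "i \<in> ?I (Suc (to_nat_on I i))" by simp
    show "f i = (SUP n. f i * indicator (?I n) i)"
    proof (rule antisym)
      show "f i \<le> (SUP n. f i * indicator (?I n) i)"
        using i by (intro SUP_upper2[of "Suc (to_nat_on I i)"]) auto
    qed (auto intro!: SUP_least split: split_indicator)
  qed
  also have "\<dots> = (SUP n. \<integral>\<^sup>+i. f i * indicator (?I n) i \<partial>count_space I)"
    by (intro nn_integral_monotone_convergence_SUP)
       (auto simp: incseq_def le_fun_def split: split_indicator)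
  also have "\<dots> = (SUP n. \<Sum>i\<in>?I n. f i)"
  proof (intro SUP_cong refl)
    fix n
    have "(\<integral>\<^sup>+i. f i * indicator (?I n) i \<partial>count_space I) = (\<integral>\<^sup>+i. f i \<partial>count_space (?I n))"
      by (subst nn_integral_count_space_indicator, simp, subst nn_integral_count_space_indicator)
         (auto intro!: nn_integral_cong split: split_indicator)
    then show "(\<integral>\<^sup>+i. f i * indicator (?I n) i \<partial>count_space I) = (\<Sum>i\<in>?I n. f i)"
      using finite_initial by (simp add: nn_integral_count_space_finite)
  qed
  finally show ?thesis .
qed

text \<open>The constant does not depend on the finite set of tents, so the level sets of the partial sums
  exhaust the level set of the full sum with a uniform bound.\<close>
theorem weak_type:
  assumes N: "\<rho> ^ N \<le> 1/2" and p: "1 \<le> p"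
    and meas [measurable]: "g \<in> borel_measurable M" "s \<in> borel_measurable M" "G \<in> borel_measurable M"
    and holder: "\<And>i E q. \<lbrakk>i \<in> I; E \<in> sets M; E \<subseteq> T i; 0 < q; emeasure M E \<le> ennreal q * emeasure M (T i)\<rbrakk>
        \<Longrightarrow> (\<integral>\<^sup>+x\<in>E. s x \<partial>M) \<le> a i * emeasure M (T i) * ennreal (q powr (1/p))"
    and dom: "\<And>i. i \<in> I \<Longrightarrow> AE x in M. x \<in> T i \<longrightarrow> a i * g x \<le> G x"
  shows "(\<integral>\<^sup>+x\<in>{x\<in>space M. 1 < (\<integral>\<^sup>+i. mean g i * indicator (T i) x \<partial>count_space I)}. s x \<partial>M)
    \<le> ennreal ((1 + 8 * real N * (6 + real N)) * (1 + ln p)) * (\<integral>\<^sup>+x. G x \<partial>M)"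
proof -
  define J where "J n = {i\<in>I. to_nat_on I i < n}" for n
  have J: "finite (J n)" "J n \<subseteq> I" for n
    unfolding J_def using finite_initial by auto
  define A where "A n = {x\<in>space M. 1 < (\<Sum>i\<in>J n. mean g i * indicator (T i) x)}" for n
  have A [measurable]: "A n \<in> sets M" for n
  proof -
    have [measurable]: "(\<lambda>x. \<Sum>i\<in>J n. mean g i * indicator (T i) x) \<in> borel_measurable M"
    proof (intro borel_measurable_sum)
      fix i assume "i \<in> J n"
      then have [measurable]: "T i \<in> sets M" using J(2)[of n] by (intro tent_sets) auto
      show "(\<lambda>x. mean g i * indicator (T i) x) \<in> borel_measurable M" by measurable
    qed
    show ?thesis unfolding A_def by measurable
  qed
  have inc: "incseq A"
  proof (unfold incseq_def, intro allI impI subsetI)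
    fix m n :: nat and x assume mn: "m \<le> n" and x: "x \<in> A m"
    have "(\<Sum>i\<in>J m. mean g i * indicator (T i) x) \<le> (\<Sum>i\<in>J n. mean g i * indicator (T i) x)"
      using mn J(1) by (intro sum_mono2) (auto simp: J_def)
    then show "x \<in> A n" using x by (auto simp: A_def)
  qed
  have eq: "{x\<in>space M. 1 < (\<integral>\<^sup>+i. mean g i * indicator (T i) x \<partial>count_space I)} = (\<Union>n. A n)"
    by (auto simp: count_space_eq_SUP less_SUP_iff A_def J_def)
  have "(\<integral>\<^sup>+x\<in>(\<Union>n. A n). s x \<partial>M) = emeasure (density M s) (\<Union>n. A n)"
    by (simp add: emeasure_density)
  also have "\<dots> = (SUP n. emeasure (density M s) (A n))"
    using inc by (intro SUP_emeasure_incseq[symmetric]) auto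
  also have "\<dots> = (SUP n. \<integral>\<^sup>+x\<in>A n. s x \<partial>M)"
    by (simp add: emeasure_density)
  also have "\<dots> \<le> ennreal ((1 + 8 * real N * (6 + real N)) * (1 + ln p)) * (\<integral>\<^sup>+x. G x \<partial>M)"
    unfolding A_def
  proof (rule SUP_least)
    fix n
    show "(\<integral>\<^sup>+x\<in>{x\<in>space M. 1 < (\<Sum>i\<in>J n. mean g i * indicator (T i) x)}. s x \<partial>M)
        \<le> ennreal ((1 + 8 * real N * (6 + real N)) * (1 + ln p)) * (\<integral>\<^sup>+x. G x \<partial>M)"
      by (rule weak_type_finite[where a = a]) (rule J N p meas holder dom; assumption)+
  qed
  finally show ?thesis unfolding eq .
qed

end

section \<open>The geometry of Carleson tents\<close>

lemma herm_diff_right: "herm w (x - y) = herm w x - herm w y"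
  by (simp add: herm_def right_diff_distrib sum_subtractf)

lemma herm_scaleR_left: "herm (c *\<^sub>R x) w = c *\<^sub>R herm x w"
  by (simp add: herm_def scaleR_sum_right)

lemma Re_herm: "Re (herm x y) = x \<bullet> y"
  by (simp add: herm_def inner_vec_def inner_complex_def)

lemma norm_herm_le: "norm (herm x y) \<le> norm x * norm y"
proof -
  have "norm (herm x y) \<le> (\<Sum>j\<in>UNIV. norm (x $ j) * norm (y $ j))"
    unfolding herm_def by (rule order_trans[OF norm_sum]) (simp add: norm_mult)
  also have "\<dots> \<le> norm x * norm y"
    using L2_set_mult_ineq[of "\<lambda>j. norm (x $ j)" "\<lambda>j. norm (y $ j)" UNIV] by (simp add: norm_vec_def)
  finally show ?thesis .
qed

lemma continuous_on_herm [continuous_intros]: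
  assumes "continuous_on A f" "continuous_on A g"
  shows "continuous_on A (\<lambda>x. herm (f x) (g x))"
  unfolding herm_def using assms by (auto intro!: continuous_intros)

lemma open_carleson_tent: "open (carleson_tent z)"
proof (cases "z = 0")
  case False
  let ?S = "{w. norm (1 - herm (z /\<^sub>R norm z) w) < 1 - norm z}"
  have "open ?S" by (intro open_Collect_less continuous_intros)
  moreover have "carleson_tent z = unit_ball \<inter> ?S" using False by (auto simp: carleson_tent_def)
  ultimately show ?thesis by (auto intro: open_Int)
qed (simp add: carleson_tent_def)

lemma borel_translation:
  fixes A :: "'a::euclidean_space set"
  assumes "A \<in> sets borel"
  shows "(+) a ` A \<in> sets borel" "emeasure lborel ((+) a ` A) = emeasure lborel A"
proof -
  have eq: "(+) a ` A = (+) (- a) -` A"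
    by (auto simp: image_iff) (metis add.commute add_diff_cancel_right' diff_add_cancel uminus_add_conv_diff)
  have "(+) (- a) \<in> borel \<rightarrow>\<^sub>M (borel :: 'a measure)" by simp
  from measurable_sets[OF this assms] show "(+) a ` A \<in> sets borel" by (simp add: eq)
  have "emeasure lborel A = emeasure (distr lborel borel ((+) (- a))) A" by (simp add: lborel_distr_plus)
  also have "\<dots> = emeasure lborel ((+) a ` A)" using assms by (subst emeasure_distr) (auto simp: eq)
  finally show "emeasure lborel ((+) a ` A) = emeasure lborel A" by simp
qed

text \<open>Packing bound: translating \<open>E\<close> by the points of a finite box in a lattice, whose spacing may
  depend on the coordinate, gives disjoint copies inside a ball of fixed radius. Assumption \<open>sep\<close>
  says that the difference of two points of \<open>E\<close> is a lattice vector for the zero index only.\<close>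
lemma lattice_translates_bound:
  fixes E :: "(complex ^ 'n::finite) set" and step :: "'n \<Rightarrow> real" and m :: "'n \<Rightarrow> nat" and R :: real
  assumes E: "E \<in> sets borel" "E \<subseteq> unit_ball"
    and step: "\<And>i. 0 \<le> step i" "\<And>i. step i * m i \<le> R"
    and sep: "\<And>x y a. x \<in> E \<Longrightarrow> y \<in> E \<Longrightarrow> (\<And>i. y $ i - x $ i = step i * Complex (of_int (fst (a i))) (of_int (snd (a i))))
       \<Longrightarrow> a = (\<lambda>_. (0, 0))"
  shows "of_nat (\<Prod>i\<in>UNIV. m i * m i) * emeasure lborel E \<le> emeasure lborel (ball (0 :: complex ^ 'n) (1 + 2 * real CARD('n) * R))"
proof -
  define F where "F = (PiE (UNIV :: 'n set) (\<lambda>i. {..<m i} \<times> {..<m i}))"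
  define v where "v f = (\<chi> i. step i * Complex (real (fst (f i))) (real (snd (f i))))" for f :: "'n \<Rightarrow> nat \<times> nat"
  have F: "finite F" "card F = (\<Prod>i\<in>UNIV. m i * m i)"
    unfolding F_def by (auto intro!: finite_PiE simp: card_PiE)
  have disj: "disjoint_family_on (\<lambda>f. (+) (v f) ` E) F"
  proof (unfold disjoint_family_on_def, intro ballI impI)
    fix f g assume fg: "f \<in> F" "g \<in> F" "f \<noteq> g"
    show "(+) (v f) ` E \<inter> (+) (v g) ` E = {}"
    proof (rule ccontr)
      assume "(+) (v f) ` E \<inter> (+) (v g) ` E \<noteq> {}"
      then obtain x y where xy: "x \<in> E" "y \<in> E" "v f + x = v g + y" by blast
      define a where "a i = (int (fst (f i)) - int (fst (g i)), int (snd (f i)) - int (snd (g i)))" for i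
      have "y $ i - x $ i = step i * Complex (of_int (fst (a i))) (of_int (snd (a i)))" for i
      proof -
        have "v f $ i + x $ i = v g $ i + y $ i" using xy(3) by (metis vector_add_component)
        then have "y $ i - x $ i = v f $ i - v g $ i" by (simp add: algebra_simps)
        then show ?thesis by (simp add: v_def a_def complex_eq_iff algebra_simps)
      qed
      then have "a = (\<lambda>_. (0, 0))" using sep[OF xy(1,2)] by blast
      then have "f i = g i" for i by (auto simp: a_def fun_eq_iff prod_eq_iff)
      then show False using fg(3) by auto
    qed
  qed
  have norm_v: "norm (v f) \<le> 2 * CARD('n) * R" if f: "f \<in> F" for f
  proof -
    have "norm (v f) \<le> (\<Sum>i\<in>UNIV. norm (v f $ i))"
      unfolding norm_vec_def by (rule L2_set_le_sum) auto
    also have "\<dots> \<le> (\<Sum>i\<in>(UNIV :: 'n set). 2 * R)"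
    proof (rule sum_mono)
      fix i
      have fi: "fst (f i) \<le> m i" "snd (f i) \<le> m i" using f by (auto simp: F_def PiE_iff mem_Times_iff less_imp_le)
      have "norm (v f $ i) = step i * norm (Complex (real (fst (f i))) (real (snd (f i))))"
        using step(1)[of i] by (simp add: v_def norm_mult)
      also have "norm (Complex (real (fst (f i))) (real (snd (f i)))) \<le> real (fst (f i)) + real (snd (f i))"
        using cmod_le[of "Complex (real (fst (f i))) (real (snd (f i)))"] by simp
      also have "step i * (real (fst (f i)) + real (snd (f i))) \<le> step i * (real (m i) + real (m i))"
        using fi step(1) by (intro mult_left_mono add_mono) auto
      also have "\<dots> \<le> 2 * R" using step(2)[of i] by (simp add: algebra_simps)
      finally show "norm (v f $ i) \<le> 2 * R" using step(1)[of i] by (simp add: mult_left_mono)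
    qed
    finally show ?thesis by simp
  qed
  have meas: "(+) (v f) ` E \<in> sets borel" for f
    using E(1) by (rule borel_translation)
  have "of_nat (\<Prod>i\<in>UNIV. m i * m i) * emeasure lborel E = (\<Sum>f\<in>F. emeasure lborel ((+) (v f) ` E))"
    using F E(1) by (simp add: borel_translation)
  also have "\<dots> = emeasure lborel (\<Union>f\<in>F. (+) (v f) ` E)"
    using F disj meas by (intro sum_emeasure) auto
  also have "\<dots> \<le> emeasure lborel (ball (0 :: complex ^ 'n) (1 + 2 * real CARD('n) * R))"
  proof (intro emeasure_mono UN_least subsetI)
    fix f x assume f: "f \<in> F" and "x \<in> (+) (v f) ` E"
    then obtain e where e: "e \<in> E" "x = v f + e" by auto
    have "norm x \<le> norm (v f) + norm e" unfolding e by (rule norm_triangle_ineq)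
    also have "\<dots> < 2 * CARD('n) * R + 1"
      using norm_v[OF f] E(2) e(1) by (intro add_le_less_mono) auto
    finally show "x \<in> ball 0 (1 + 2 * real CARD('n) * R)" by (simp add: add.commute)
  qed auto
  finally show ?thesis .
qed


lemma large_coordinate:
  fixes z :: "complex ^ 'n::finite"
  obtains j where "norm z \<le> CARD('n) * norm (z $ j)"
proof -
  have "Max (range (\<lambda>i. norm (z $ i))) \<in> range (\<lambda>i. norm (z $ i))" by (intro Max_in) auto
  then obtain j where "norm (z $ j) = Max (range (\<lambda>i. norm (z $ i)))" by (metis rangeE)
  then have j: "norm (z $ i) \<le> norm (z $ j)" for i by (simp add: Max_ge)
  have "norm z \<le> (\<Sum>i\<in>UNIV. norm (z $ i))"
    unfolding norm_vec_def by (rule L2_set_le_sum) auto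
  also have "\<dots> \<le> (\<Sum>i\<in>(UNIV :: 'n set). norm (z $ j))" by (intro sum_mono j)
  finally show ?thesis using that[of j] by simp
qed

lemma Complex_of_int_small:
  assumes "norm (Complex (of_int a) (of_int b)) < 1"
  shows "a = 0" "b = 0"
proof -
  have "\<bar>real_of_int a\<bar> < 1" "\<bar>real_of_int b\<bar> < 1"
    using abs_Re_le_cmod[of "Complex (of_int a) (of_int b)"] abs_Im_le_cmod[of "Complex (of_int a) (of_int b)"] assms
    by auto
  then show "a = 0" "b = 0" by linarith+
qed

text \<open>With \<open>\<delta> = 1 - |z|\<close> and \<open>\<zeta> = z / |z|\<close>, the tent has extent \<open>\<delta>\<close> in the complex direction \<open>\<zeta>\<close> and
  \<open>sqrt \<delta>\<close> in the others. Instead of rotating \<open>\<zeta>\<close> to a coordinate axis, a coordinate \<open>l\<close> is chosen in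
  which \<open>\<zeta>\<close> is large; the lattice with spacing of order \<open>\<delta>\<close> in coordinate \<open>l\<close> and \<open>sqrt \<delta>\<close> in the
  remaining ones separates the points of the tent, and a bounded box contains at least
  \<open>\<delta>\<^sup>-\<^sup>2 (\<delta>\<^sup>-\<^sup>1)\<^sup>n\<^sup>-\<^sup>1 = \<delta>\<^sup>-\<^sup>n\<^sup>-\<^sup>1\<close> of its points.\<close>
lemma carleson_tent_lborel_le:
  fixes z :: "complex ^ 'n::finite"
  assumes z: "z \<noteq> 0" "norm z < 1"
  shows "ennreal (1 / (1 - norm z) ^ (CARD('n) + 1)) * emeasure lborel (carleson_tent z)
    \<le> emeasure lborel (ball (0 :: complex ^ 'n) (1 + 2 * real CARD('n) * (6 * real CARD('n))))"
proof -
  define \<delta> where "\<delta> = 1 - norm z"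
  have \<delta>: "0 < \<delta>" "\<delta> < 1" using z by (auto simp: \<delta>_def)
  define \<zeta> where "\<zeta> = z /\<^sub>R norm z"
  have n\<zeta>: "norm \<zeta> = 1" using z by (simp add: \<zeta>_def)
  obtain l where l: "norm \<zeta> \<le> CARD('n) * norm (\<zeta> $ l)" by (rule large_coordinate)
  define n where "n = real CARD('n)"
  have n: "1 \<le> n" by (simp add: n_def Suc_le_eq)
  define step where "step i = (if i = l then 2 * n * \<delta> else 3 * sqrt \<delta>)" for i
  define w where "w i = (if i = l then 1 / \<delta> else 1 / sqrt \<delta>)" for i
  define m where "m i = nat \<lceil>w i\<rceil>" for i
  have w1: "1 \<le> w i" for i using \<delta> by (auto simp: w_def)
  have m: "w i \<le> m i" "m i \<le> 2 * w i" for i using w1[of i] unfolding m_def by linarith+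
  have tent: "norm w < 1" "norm (1 - herm \<zeta> w) < \<delta>" if "w \<in> carleson_tent z" for w
    using that z by (auto simp: carleson_tent_def \<zeta>_def \<delta>_def)
  \<comment> \<open>The extent in all directions: \<open>|w - \<zeta>|\<^sup>2 \<le> 2 Re (1 - \<langle>\<zeta>, w\<rangle>)\<close>.\<close>
  have near: "norm (w - \<zeta>) < sqrt (2 * \<delta>)" if "w \<in> carleson_tent z" for w
  proof -
    have "(norm (w - \<zeta>))\<^sup>2 = (norm w)\<^sup>2 + 1 - 2 * Re (herm \<zeta> w)"
      by (simp add: power2_norm_eq_inner algebra_simps inner_commute Re_herm)
         (simp add: power2_norm_eq_inner[symmetric] n\<zeta>)
    also have "\<dots> \<le> 2 * Re (1 - herm \<zeta> w)" using tent[OF that] by (simp add: power_le_one)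
    also have "\<dots> < 2 * \<delta>" using tent(2)[OF that] complex_Re_le_cmod[of "1 - herm \<zeta> w"] by simp
    finally show ?thesis by (intro real_less_rsqrt)
  qed
  have dist: "norm (y - x) < 3 * sqrt \<delta>" if "x \<in> carleson_tent z" "y \<in> carleson_tent z" for x y
  proof -
    have "norm (y - x) \<le> norm (y - \<zeta>) + norm (x - \<zeta>)"
      by (metis dist_norm dist_triangle2)
    also have "\<dots> < 2 * sqrt (2 * \<delta>)" using add_strict_mono[OF near[OF that(2)] near[OF that(1)]] by simp
    also have "\<dots> = (2 * sqrt 2) * sqrt \<delta>" by (simp add: real_sqrt_mult)
    also have "\<dots> \<le> 3 * sqrt \<delta>"
    proof (intro mult_right_mono)
      have "sqrt 2 \<le> 3 / 2" by (intro real_le_lsqrt) (auto simp: power2_eq_square)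
      then show "2 * sqrt 2 \<le> 3" by simp
    qed (use \<delta> in auto)
    finally show ?thesis .
  qed
  have "of_nat (\<Prod>i\<in>UNIV. m i * m i) * emeasure lborel (carleson_tent z)
      \<le> emeasure lborel (ball (0 :: complex ^ 'n) (1 + 2 * real CARD('n) * (6 * real CARD('n))))"
  proof (rule lattice_translates_bound)
    show "carleson_tent z \<in> sets borel" by (intro borel_open open_carleson_tent)
    show "carleson_tent z \<subseteq> unit_ball" by (auto simp: carleson_tent_def)
    show "0 \<le> step i" for i using \<delta> n by (auto simp: step_def)
    show "step i * real (m i) \<le> 6 * real CARD('n)" for i
    proof -
      have "step i * real (m i) \<le> step i * (2 * w i)"
        using \<delta> n m by (intro mult_left_mono) (auto simp: step_def)
      also have "\<dots> \<le> 6 * n" using \<delta> n by (auto simp: step_def w_def)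
      finally show ?thesis by (simp add: n_def)
    qed
    fix x y :: "complex ^ 'n" and a :: "'n \<Rightarrow> int \<times> int"
    assume x: "x \<in> carleson_tent z" and y: "y \<in> carleson_tent z"
      and a: "\<And>i. y $ i - x $ i = of_real (step i) * Complex (of_int (fst (a i))) (of_int (snd (a i)))"
    define c where "c i = Complex (of_int (fst (a i))) (of_int (snd (a i)))" for i
    have na: "norm (y $ i - x $ i) = step i * norm (c i)" for i
      using a[of i] \<delta> n by (simp add: c_def norm_mult step_def)
    have zero: "a i = (0, 0)" if "norm (c i) < 1" for i
      using Complex_of_int_small that unfolding c_def by (simp add: prod_eq_iff)
    \<comment> \<open>Once the other coordinates of the difference vanish, its product with \<open>\<zeta>\<close> involves coordinate
      \<open>l\<close> only, where the finer extent \<open>\<delta>\<close> of the tent applies.\<close>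
    have off: "a i = (0, 0)" if "i \<noteq> l" for i
    proof -
      have "3 * sqrt \<delta> * norm (c i) = norm ((y - x) $ i)" using na[of i] that by (simp add: step_def)
      also have "\<dots> \<le> norm (y - x)" by (rule Finite_Cartesian_Product.norm_nth_le)
      also have "\<dots> < 3 * sqrt \<delta>" by (rule dist[OF x y])
      finally show ?thesis using \<delta> by (intro zero) simp
    qed
    then have off0: "(y - x) $ i = 0" if "i \<noteq> l" for i
      using a[of i] that by (simp add: complex_eq_iff)
    have "herm \<zeta> (y - x) = \<zeta> $ l * cnj ((y - x) $ l)"
      unfolding herm_def using off0 by (subst sum.remove[of UNIV l]) auto
    then have "norm (\<zeta> $ l) * (2 * n * \<delta> * norm (c l)) = norm (herm \<zeta> (y - x))"
      using na[of l] by (simp add: norm_mult step_def flip: complex_cnj_diff)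
    also have "\<dots> = norm ((1 - herm \<zeta> x) - (1 - herm \<zeta> y))" by (simp add: herm_diff_right)
    also have "\<dots> < \<delta> + \<delta>" using tent(2)[OF x] tent(2)[OF y] by (intro norm_triangle_lt order_le_less_trans[OF norm_triangle_ineq4]) auto
    finally have "(n * norm (\<zeta> $ l)) * norm (c l) < 1" using \<delta> by (simp add: mult_ac)
    moreover have "1 * norm (c l) \<le> (n * norm (\<zeta> $ l)) * norm (c l)"
      using l n\<zeta> by (intro mult_right_mono) (auto simp: n_def)
    ultimately have "a l = (0, 0)" by (intro zero) simp
    then show "a = (\<lambda>_. (0, 0))" using off by (metis ext)
  qed
  moreover have "ennreal (1 / \<delta> ^ (CARD('n) + 1)) \<le> of_nat (\<Prod>i\<in>UNIV. m i * m i)"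
  proof -
    have "1 / \<delta> ^ (CARD('n) + 1) = (\<Prod>i\<in>UNIV. w i * w i)"
    proof -
      have "(\<Prod>i\<in>UNIV. w i * w i) = (w l * w l) * (\<Prod>i\<in>UNIV - {l}. w i * w i)"
        by (subst prod.remove[of UNIV l]) auto
      also have "(\<Prod>i\<in>UNIV - {l}. w i * w i) = (\<Prod>i\<in>UNIV - {l}. 1 / \<delta>)"
        using \<delta> by (intro prod.cong) (auto simp: w_def)
      also have "\<dots> = (1 / \<delta>) ^ (CARD('n) - 1)" by simp
      also have "w l * w l * \<dots> = (1 / \<delta>) ^ (2 + (CARD('n) - 1))"
        by (simp only: power_add) (simp add: w_def power2_eq_square)
      also have "2 + (CARD('n) - 1) = CARD('n) + 1" by (simp add: Suc_leI)
      finally show ?thesis by (simp add: power_divide)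
    qed
    also have "\<dots> \<le> (\<Prod>i\<in>UNIV. real (m i) * real (m i))"
      using m w1 by (intro prod_mono conjI mult_mono) (auto intro: order_trans[OF zero_le_one])
    finally have "ennreal (1 / \<delta> ^ (CARD('n) + 1)) \<le> ennreal (\<Prod>i\<in>UNIV. real (m i) * real (m i))"
      by (rule ennreal_leI)
    also have "\<dots> = of_nat (\<Prod>i\<in>UNIV. m i * m i)"
      by (simp flip: ennreal_of_nat_eq_real_of_nat of_nat_mult of_nat_prod)
    finally show ?thesis .
  qed
  ultimately show ?thesis unfolding \<delta>_def by (meson mult_right_mono order_trans zero_le)
qed

lemma emeasure_unit_ball:
  "emeasure lborel (unit_ball :: (complex ^ 'n::finite) set) \<noteq> 0"
  "emeasure lborel (unit_ball :: (complex ^ 'n::finite) set) \<noteq> \<infinity>"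
proof -
  show "emeasure lborel (unit_ball :: (complex ^ 'n) set) \<noteq> 0"
    using content_ball_pos[of 1 "0 :: complex ^ 'n"] by (auto simp: measure_def)
  show "emeasure lborel (unit_ball :: (complex ^ 'n) set) \<noteq> \<infinity>"
    using emeasure_lborel_ball_finite[of "0 :: complex ^ 'n" 1] by simp
qed

lemma space_V [simp]: "space V = unit_ball"
  by (simp add: V_def space_restrict_space)

lemma sets_V_iff: "A \<in> sets V \<longleftrightarrow> A \<subseteq> unit_ball \<and> A \<in> sets lebesgue"
  unfolding V_def by (subst sets_restrict_space_iff) auto

lemma borel_imp_sets_V: "A \<in> sets borel \<Longrightarrow> A \<subseteq> unit_ball \<Longrightarrow> A \<in> sets V"
  by (simp add: sets_V_iff)

lemma emeasure_V:
  fixes A :: "(complex ^ 'n::finite) set"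
  assumes "A \<in> sets borel" "A \<subseteq> unit_ball"
  shows "emeasure V A = emeasure lborel A / emeasure lborel (unit_ball :: (complex ^ 'n::finite) set)"
proof -
  have "emeasure V A = emeasure (uniform_measure lebesgue unit_ball) A"
    unfolding V_def using assms by (subst emeasure_restrict_space) auto
  also have "\<dots> = emeasure lebesgue (unit_ball \<inter> A) / emeasure lebesgue (unit_ball :: (complex ^ 'n) set)"
    using assms by (subst emeasure_uniform_measure) auto
  also have "unit_ball \<inter> A = A" using assms by auto
  finally show ?thesis using assms by simp
qed

interpretation V: prob_space "V :: (complex ^ 'n::finite) measure"
proof
  show "emeasure V (space V :: (complex ^ 'n) set) = 1"
    using emeasure_unit_ball[where 'n = 'n] by (simp add: emeasure_V ennreal_divide_self less_top)
qed

lemma borel_measurable_V: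
  assumes "f \<in> borel_measurable borel"
  shows "f \<in> borel_measurable V"
proof -
  have "f \<in> borel_measurable lebesgue" using assms by (intro measurable_completion) simp
  then show ?thesis unfolding V_def
    by (intro measurable_restrict_space1) simp
qed

lemma carleson_tent_subset: "carleson_tent z \<subseteq> unit_ball"
  by (auto simp: carleson_tent_def)

lemma carleson_tent_volume:
  "\<exists>C\<ge>1. \<forall>z\<in>(unit_ball :: (complex ^ 'n::finite) set).
     emeasure V (carleson_tent z) \<le> ennreal (C * (1 - norm z) ^ (CARD('n) + 1))"
proof -
  let ?B = "ball (0 :: complex ^ 'n) (1 + 2 * real CARD('n) * (6 * real CARD('n)))"
  let ?b = "emeasure lborel (unit_ball :: (complex ^ 'n) set)"
  obtain K where K: "emeasure lborel ?B / ?b = ennreal K" "0 \<le> K"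
  proof -
    have "emeasure lborel ?B / ?b \<noteq> \<infinity>"
      using emeasure_unit_ball[where 'n = 'n] emeasure_lborel_ball_finite[of "0 :: complex ^ 'n" "1 + 2 * real CARD('n) * (6 * real CARD('n))"]
      by (auto simp: ennreal_divide_eq_top_iff)
    then show ?thesis using that by (cases "emeasure lborel ?B / ?b") auto
  qed
  have "emeasure V (carleson_tent z) \<le> ennreal (max 1 K * (1 - norm z) ^ (CARD('n) + 1))"
    if z: "z \<in> unit_ball" for z :: "complex ^ 'n"
  proof (cases "z = 0")
    case False
    let ?d = "(1 - norm z) ^ (CARD('n) + 1)"
    have d: "0 < ?d" using z by simp
    have "emeasure lborel (carleson_tent z) = ennreal ?d * (ennreal (1 / ?d) * emeasure lborel (carleson_tent z))"
      unfolding mult.assoc[symmetric] using d by (subst ennreal_mult[symmetric]) auto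
    also have "\<dots> \<le> ennreal ?d * emeasure lborel ?B"
      using z False by (intro mult_left_mono carleson_tent_lborel_le) auto
    finally have "emeasure lborel (carleson_tent z) / ?b \<le> ennreal ?d * emeasure lborel ?B / ?b"
      by (rule divide_right_mono_ennreal)
    then have "emeasure V (carleson_tent z) \<le> ennreal ?d * (emeasure lborel ?B / ?b)"
      by (simp add: emeasure_V borel_open open_carleson_tent carleson_tent_subset ennreal_times_divide)
    also have "\<dots> = ennreal (K * ?d)" using K d by (simp add: ennreal_mult mult.commute)
    also have "\<dots> \<le> ennreal (max 1 K * ?d)" using d by (intro ennreal_leI mult_right_mono) auto
    finally show ?thesis .
  qed (auto intro!: V.emeasure_le_1 order_trans[OF V.emeasure_le_1])
  then show ?thesis by (intro exI[of _ "max 1 K"]) auto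
qed

lemma norm_one_minus_herm_ge:
  assumes "z \<in> unit_ball" "w \<in> unit_ball"
  shows "1 - norm z \<le> norm (1 - herm z w)" "0 < norm (1 - herm z w)"
proof -
  have "norm (herm z w) \<le> norm z * 1"
    using assms by (intro order_trans[OF norm_herm_le] mult_left_mono) auto
  moreover have "1 - norm (herm z w) \<le> norm (1 - herm z w)"
    using norm_triangle_ineq2[of 1 "herm z w"] by simp
  ultimately show "1 - norm z \<le> norm (1 - herm z w)" by simp
  moreover have "0 < 1 - norm z" using assms by simp
  ultimately show "0 < norm (1 - herm z w)" by linarith
qed

text \<open>The tent points in the direction \<open>e\<close> of \<open>z\<close>: passing from \<open>z\<close> to \<open>e\<close> changes the Hermitian
  product with \<open>w\<close> by at most \<open>1 - |z| \<le> d\<close>, so that both points are within \<open>2 d\<close> of the boundary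
  point \<open>e\<close>; the factor 3 makes the inequalities strict. If \<open>3 d \<ge> 1\<close>, the whole ball serves as the tent.\<close>
lemma carleson_tent_through_points:
  fixes z w :: "complex ^ 'n::finite"
  assumes zw: "z \<in> unit_ball" "w \<in> unit_ball"
  obtains \<zeta> where "\<zeta> \<in> unit_ball" "z \<in> carleson_tent \<zeta>" "w \<in> carleson_tent \<zeta>"
    "1 - norm \<zeta> \<le> 3 * norm (1 - herm z w)"
proof -
  define d where "d = norm (1 - herm z w)"
  have d: "1 - norm z \<le> d" "0 < d" using norm_one_minus_herm_ge[OF zw] by (auto simp: d_def)
  show thesis
  proof (cases "3 * d < 1")
    case False
    then show thesis using zw by (intro that[of 0]) (auto simp: carleson_tent_def d_def)
  next
    case True
    then have z0: "z \<noteq> 0" using d by auto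
    define e where "e = z /\<^sub>R norm z"
    have e: "norm e = 1" "z = norm z *\<^sub>R e" using z0 by (auto simp: e_def)
    define \<zeta> where "\<zeta> = (1 - 3 * d) *\<^sub>R e"
    have \<zeta>: "norm \<zeta> = 1 - 3 * d" "\<zeta> \<noteq> 0" "\<zeta> /\<^sub>R norm \<zeta> = e"
      using e True by (auto simp: \<zeta>_def) 
    have mem: "x \<in> carleson_tent \<zeta>" if "x \<in> unit_ball" "norm (1 - herm e x) < 3 * d" for x
      using that \<zeta> by (auto simp: carleson_tent_def)
    have "herm e z = of_real (norm z)"
      unfolding e_def herm_scaleR_left herm_self using z0 by (simp add: power2_eq_square scaleR_conv_of_real)
    then have "1 - herm e z = of_real (1 - norm z)" by simp
    then have "norm (1 - herm e z) = 1 - norm z"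
      using zw by (simp only: norm_of_real) auto
    then have zT: "z \<in> carleson_tent \<zeta>" using zw d by (intro mem) auto
    have "herm z w = norm z *\<^sub>R herm e w" unfolding herm_scaleR_left[symmetric] using e(2) by (rule arg_cong[where f = "\<lambda>x. herm x w"])
    then have eq: "1 - herm e w = (1 - herm z w) - (1 - norm z) *\<^sub>R herm e w"
      by (simp add: algebra_simps)
    have "norm (1 - herm e w) \<le> d + norm ((1 - norm z) *\<^sub>R herm e w)"
      unfolding eq d_def by (rule norm_triangle_ineq4)
    also have "norm ((1 - norm z) *\<^sub>R herm e w) \<le> (1 - norm z) * (norm e * norm w)"
      using zw by (simp add: mult_left_mono norm_herm_le)
    also have "\<dots> \<le> (1 - norm z) * 1" using zw e by (intro mult_left_mono) auto
    finally have "norm (1 - herm e w) \<le> 2 * d" using d by simp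
    then have wT: "w \<in> carleson_tent \<zeta>" using zw d by (intro mem) auto
    show thesis using \<zeta> d True zT wT by (intro that[of \<zeta>]) (auto simp: d_def)
  qed
qed

section \<open>Dyadic tents form a sparse tree\<close>

lemma radial_proj_borel [measurable]: "radial_proj s \<in> borel_measurable (borel :: (complex ^ 'n::finite) measure)"
proof -
  have "(\<lambda>z :: complex ^ 'n. (tanh s / norm z) *\<^sub>R z) \<in> borel_measurable borel" by measurable
  then show ?thesis by (simp add: radial_proj_def[abs_def])
qed

lemma bergman_0_borel [measurable]: "bergman 0 \<in> borel_measurable (borel :: (complex ^ 'n::finite) measure)"
proof -
  have "(\<lambda>z :: complex ^ 'n. ln ((1 + norm z) / (1 - norm z)) / 2) \<in> borel_measurable borel" by measurable
  moreover have "bergman 0 = (\<lambda>z :: complex ^ 'n. ln ((1 + norm z) / (1 - norm z)) / 2)"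
    by (auto simp: fun_eq_iff bergman_0 artanh_def)
  ultimately show ?thesis by simp
qed

lemma norm_radial_proj_less: "norm (radial_proj s z) < 1"
proof (cases "z = 0")
  case False
  then show ?thesis using tanh_real_bounds[of s] by (auto simp: radial_proj_def abs_less_iff)
qed (simp add: radial_proj_def)

lemma norm_kube_center_less: "norm (kube_center \<theta> S p) < 1"
  by (cases p) (auto simp: norm_radial_proj_less)

lemma kube_subset: "kube \<theta> S p \<subseteq> unit_ball"
  by (cases p) auto

lemma dyadic_tent_subset: "dyadic_tent \<theta> S p \<subseteq> unit_ball"
  using kube_subset unfolding dyadic_tent_def by blast

lemma dyadic_tent_eq:
  assumes "p \<in> kube_index S"
  shows "dyadic_tent \<theta> S p = (\<Union>q\<in>{q\<in>kube_index S. q = p \<or> descendant \<theta> S q p}. kube \<theta> S q)"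
  using assms unfolding dyadic_tent_def by blast

lemma descendant_gen: "descendant \<theta> S q p \<Longrightarrow> fst p < fst q"
  by (cases p; cases q) auto

locale dyadic_structure =
  fixes \<theta> lam C0 :: real and S :: "'n::finite dyadic_data"
  assumes theta: "0 < \<theta>" and data: "is_dyadic_data \<theta> lam C0 S"
begin

lemma kube_sets:
  assumes "p \<in> kube_index S"
  shows "kube \<theta> S p \<in> sets borel"
proof (cases p)
  case (Pair k j)
  show ?thesis
  proof (cases "k = 0")
    case False
    then have [measurable]: "cell S k j \<in> sets borel"
      using assms data Pair by (auto simp: is_dyadic_data_def kube_index_def)
    have "{z \<in> unit_ball. real k * \<theta> < bergman 0 z \<and> bergman 0 z \<le> real (k + 1) * \<theta> \<and>
              radial_proj (real k * \<theta>) z \<in> cell S k j} \<in> sets borel" by measurable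
    then show ?thesis using False Pair by simp
  next
    case True
    have "{z \<in> unit_ball :: (complex ^ 'n) set. bergman 0 z \<le> \<theta>} \<in> sets borel" by measurable
    then show ?thesis using True Pair by simp
  qed
qed

lemma kube_disjoint_gen:
  assumes "fst p < fst q"
  shows "kube \<theta> S p \<inter> kube \<theta> S q = {}"
proof (rule ccontr)
  assume "kube \<theta> S p \<inter> kube \<theta> S q \<noteq> {}"
  then obtain z where z: "z \<in> kube \<theta> S p" "z \<in> kube \<theta> S q" by blast
  have "bergman 0 z \<le> real (fst p + 1) * \<theta>" using z(1) by (cases p) (auto split: if_splits)
  also have "\<dots> \<le> real (fst q) * \<theta>" using assms theta by (intro mult_right_mono) auto
  also have "\<dots> < bergman 0 z" using z(2) assms by (cases q) (auto split: if_splits)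
  finally show False by simp
qed

lemma kube_disjoint:
  assumes "p \<in> kube_index S" "q \<in> kube_index S" "p \<noteq> q"
  shows "kube \<theta> S p \<inter> kube \<theta> S q = {}"
proof -
  obtain k i l j where pq: "p = (k, i)" "q = (l, j)" by (cases p; cases q)
  consider "k < l" | "l < k" | "k = l" by linarith
  then show ?thesis
  proof cases
    case 3
    then have "k \<ge> 1" "i \<in> {1..num S k}" "j \<in> {1..num S k}" "i \<noteq> j"
      using assms pq by (auto simp: kube_index_def)
    then have "cell S k i \<inter> cell S k j = {}"
      using data unfolding is_dyadic_data_def disjoint_family_on_def by blast
    then show ?thesis using pq 3 \<open>k \<ge> 1\<close> by auto
  qed (use kube_disjoint_gen[of p q] kube_disjoint_gen[of q p] pq in auto)
qed

lemma dyadic_tent_borel: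
  assumes "p \<in> kube_index S"
  shows "dyadic_tent \<theta> S p \<in> sets borel"
  unfolding dyadic_tent_eq[OF assms]
  by (rule sets.countable_UN') (simp_all add: kube_sets image_subset_iff)

lemma kube_subset_tent: "kube \<theta> S p \<subseteq> dyadic_tent \<theta> S p"
  by (auto simp: dyadic_tent_def)

lemma kube_disjoint_tent:
  assumes "fst p < fst q"
  shows "kube \<theta> S p \<inter> dyadic_tent \<theta> S q = {}"
proof -
  have "kube \<theta> S p \<inter> kube \<theta> S r = {}" if "r = q \<or> descendant \<theta> S r q" for r
    using that assms descendant_gen[of \<theta> S r q] by (intro kube_disjoint_gen) auto
  then show ?thesis unfolding dyadic_tent_def by fastforce
qed

lemma kube_disjoint_tent_same_gen:
  assumes pq: "p \<in> kube_index S" "q \<in> kube_index S" "fst p = fst q" "p \<noteq> q"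
  shows "kube \<theta> S p \<inter> dyadic_tent \<theta> S q = {}"
proof -
  have "kube \<theta> S p \<inter> kube \<theta> S r = {}" if "descendant \<theta> S r q" for r
    using that pq(3) descendant_gen[of \<theta> S r q] by (intro kube_disjoint_gen) auto
  then show ?thesis using kube_disjoint[OF pq(1,2,4)] unfolding dyadic_tent_def by blast
qed

text \<open>The cells of generation \<open>k\<close> cover their sphere, so one of them contains the projection of the
  center. The center is nonzero, as the projection of the origin would be the origin.\<close>
lemma parent_exists:
  assumes p: "p \<in> kube_index S" "fst p = Suc k"
  shows "\<exists>q\<in>kube_index S. fst q = k \<and> descendant \<theta> S p q"
proof (cases "k = 0")
  case True
  then show ?thesis using p by (intro bexI[of _ "(0, 1)"]) (auto simp: kube_index_def)
next
  case False
  obtain j where pj: "p = (Suc k, j)" using p(2) by (cases p) auto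
  let ?w = "point S (Suc k) j"
  have "?w \<in> bergman_sphere (real (Suc k) * \<theta>)"
  proof -
    have j: "j \<in> {1..num S (Suc k)}" using p(1) pj by (auto simp: kube_index_def)
    have "\<forall>j\<in>{1..num S (Suc k)}. point S (Suc k) j \<in> cell S (Suc k) j \<and>
        cell S (Suc k) j \<subseteq> bergman_sphere (real (Suc k) * \<theta>)"
      using data[unfolded is_dyadic_data_def, rule_format, of "Suc k"] by auto
    then show ?thesis using j by blast
  qed
  moreover have "0 < real (Suc k) * \<theta>" using theta by simp
  ultimately have w0: "?w \<noteq> 0" by (auto simp: bergman_sphere_def bergman_0)
  have "tanh ((real (Suc k) + 1/2) * \<theta>) > 0" using theta by (intro tanh_real_pos_iff[THEN iffD2] mult_pos_pos) auto
  then have "kube_center \<theta> S p \<noteq> 0" using w0 theta by (simp add: pj radial_proj_def)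
  then have "radial_proj (real k * \<theta>) (kube_center \<theta> S p) \<in> bergman_sphere (real k * \<theta>)"
    using theta by (intro radial_proj_in_sphere) auto
  also have "bergman_sphere (real k * \<theta>) = (\<Union>j\<in>{1..num S k}. cell S k j)"
    using data False by (auto simp: is_dyadic_data_def)
  finally obtain i where i: "i \<in> {1..num S k}" "radial_proj (real k * \<theta>) (kube_center \<theta> S p) \<in> cell S k i"
    by blast
  then show ?thesis using False pj by (intro bexI[of _ "(k, i)"]) (auto simp: kube_index_def)
qed

text \<open>Kubes are nonempty because their measure is comparable to a positive number. A tent of
  generation \<open>k\<close> contains its own kube, which no other tent of generation at least \<open>k\<close> meets; this fixes the
  direction of every inclusion, and it is the part of the tent that the next generation leaves uncovered.\<close>
lemma is_tent_tree:
  assumes nest: "\<And>p q. p \<in> kube_index S \<Longrightarrow> q \<in> kube_index S \<Longrightarrow>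
        dyadic_tent \<theta> S p \<inter> dyadic_tent \<theta> S q = {} \<or>
        dyadic_tent \<theta> S p \<subseteq> dyadic_tent \<theta> S q \<or> dyadic_tent \<theta> S q \<subseteq> dyadic_tent \<theta> S p"
    and c: "1 < c"
    and kt: "\<And>p. p \<in> kube_index S \<Longrightarrow> emeasure V (dyadic_tent \<theta> S p) \<le> ennreal c * emeasure V (kube \<theta> S p)"
    and tc: "\<And>p. p \<in> kube_index S \<Longrightarrow>
        ennreal ((1 - (norm (kube_center \<theta> S p))\<^sup>2) ^ (CARD('n) + 1)) \<le> ennreal c * emeasure V (dyadic_tent \<theta> S p)"
  shows "tent_tree V (kube_index S) (dyadic_tent \<theta> S) fst (1 - 1 / c)"
proof -
  have tpos: "emeasure V (dyadic_tent \<theta> S p) \<noteq> 0" if "p \<in> kube_index S" for p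
  proof
    assume "emeasure V (dyadic_tent \<theta> S p) = 0"
    moreover have "(norm (kube_center \<theta> S p))\<^sup>2 < 1"
      using norm_kube_center_less[of \<theta> S p] by (simp add: power_less_one_iff abs_square_less_1)
    then have "0 < (1 - (norm (kube_center \<theta> S p))\<^sup>2) ^ (CARD('n) + 1)" by (intro zero_less_power) simp
    ultimately show False using tc[OF that] by simp
  qed
  have ne: "kube \<theta> S p \<noteq> {}" if "p \<in> kube_index S" for p
    using kt[OF that] tpos[OF that] by auto
  have nested: "dyadic_tent \<theta> S q \<subseteq> dyadic_tent \<theta> S p"
    if pq: "p \<in> kube_index S" "q \<in> kube_index S" "fst p \<le> fst q" "dyadic_tent \<theta> S p \<inter> dyadic_tent \<theta> S q \<noteq> {}" for p q
  proof (cases "p = q")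
    case False
    have "kube \<theta> S p \<inter> dyadic_tent \<theta> S q = {}"
      using kube_disjoint_tent[of p q] kube_disjoint_tent_same_gen[OF pq(1,2) _ False] pq(3) by (cases "fst p = fst q") auto
    then have "\<not> dyadic_tent \<theta> S p \<subseteq> dyadic_tent \<theta> S q" using ne[OF pq(1)] kube_subset_tent[of p] by blast
    then show ?thesis using nest[OF pq(1,2)] pq(4) by blast
  qed simp
  show ?thesis
  proof
    show "countable (kube_index S)" by simp
    show "dyadic_tent \<theta> S p \<in> sets V" if "p \<in> kube_index S" for p
      using that by (intro borel_imp_sets_V dyadic_tent_borel dyadic_tent_subset)
    show "emeasure V (dyadic_tent \<theta> S p) \<noteq> \<infinity>" for p by simp
    show "p = q" if pq: "p \<in> kube_index S" "q \<in> kube_index S" "fst p = fst q"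
        "dyadic_tent \<theta> S p \<inter> dyadic_tent \<theta> S q \<noteq> {}" for p q
    proof (rule ccontr)
      assume "p \<noteq> q"
      then have "kube \<theta> S p \<inter> dyadic_tent \<theta> S q = {}" by (rule kube_disjoint_tent_same_gen[OF pq(1,2,3)])
      moreover have "dyadic_tent \<theta> S p \<subseteq> dyadic_tent \<theta> S q" using pq by (intro nested) auto
      ultimately show False using ne[OF pq(1)] kube_subset_tent[of p] by blast
    qed
    show "\<exists>i\<in>kube_index S. fst i = k \<and> dyadic_tent \<theta> S j \<subseteq> dyadic_tent \<theta> S i"
      if j: "j \<in> kube_index S" "fst j = Suc k" for j k
    proof -
      obtain i where i: "i \<in> kube_index S" "fst i = k" "descendant \<theta> S j i"
        using parent_exists[OF j] by blast
      then have "kube \<theta> S j \<subseteq> dyadic_tent \<theta> S i" using j by (auto simp: dyadic_tent_def)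
      then have "dyadic_tent \<theta> S j \<subseteq> dyadic_tent \<theta> S i"
        using i j ne[OF j(1)] kube_subset_tent[of j] by (intro nested) auto
      then show ?thesis using i by blast
    qed
    show "0 < 1 - 1 / c" "1 - 1 / c < 1" using c by auto
    fix p assume p: "p \<in> kube_index S"
    let ?T = "dyadic_tent \<theta> S p" and ?K = "kube \<theta> S p"
    have [measurable]: "?T \<in> sets V" "?K \<in> sets V"
      using p by (auto intro!: borel_imp_sets_V dyadic_tent_borel dyadic_tent_subset kube_sets kube_subset)
    have "?K \<inter> (\<Union>j\<in>{j \<in> kube_index S. fst j = Suc (fst p)}. dyadic_tent \<theta> S j) = {}"
    proof -
      have "?K \<inter> dyadic_tent \<theta> S j = {}" if "fst j = Suc (fst p)" for j
        using that by (intro kube_disjoint_tent) simp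
      then show ?thesis by (auto simp: disjoint_iff)
    qed
    then have "emeasure V (?T \<inter> (\<Union>j\<in>{j \<in> kube_index S. fst j = Suc (fst p)}. dyadic_tent \<theta> S j))
        \<le> emeasure V (?T - ?K)"
      by (intro emeasure_mono) auto
    also have "\<dots> = ennreal (measure V ?T - measure V ?K)"
      using kube_subset_tent[of p] by (simp add: V.emeasure_eq_measure V.finite_measure_Diff)
    also have "measure V ?T \<le> c * measure V ?K"
      using kt[OF p] c by (simp add: V.emeasure_eq_measure ennreal_mult[symmetric])
    then have "ennreal (measure V ?T - measure V ?K) \<le> ennreal ((1 - 1 / c) * measure V ?T)"
      using c by (intro ennreal_leI) (simp add: field_simps)
    also have "\<dots> = ennreal (1 - 1 / c) * emeasure V ?T"
      using c by (simp add: ennreal_mult V.emeasure_eq_measure)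
    finally show "emeasure V (?T \<inter> (\<Union>j\<in>{j \<in> kube_index S. fst j = Suc (fst p)}. dyadic_tent \<theta> S j))
        \<le> ennreal (1 - 1 / c) * emeasure V ?T" .
  qed (use nested tpos in auto)
qed

end

section \<open>Sparse domination and Hoelder's inequality\<close>

lemma powr_split:
  fixes x l r :: real
  assumes "0 \<le> x" "0 < l" "1 < r"
  shows "x \<le> l + l powr (1 - r) * x powr r"
proof (cases "x \<le> l")
  case True
  then show ?thesis by (simp add: add_increasing2)
next
  case False
  then have x: "l < x" "0 < x" using assms by auto
  have "x = x powr (1 - r) * x powr r" using x by (simp add: powr_add[symmetric])
  also have "\<dots> \<le> l powr (1 - r) * x powr r"
    using x assms by (intro mult_right_mono powr_mono2') auto
  finally show ?thesis using assms by simp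
qed

text \<open>Hoelder's inequality for the indicator of \<open>E\<close>, with the harmless factor 2: by \<open>powr_split\<close>, \<open>f\<close> is at most
  \<open>l\<close> plus a multiple of \<open>f\<^sup>r\<close>, and the level \<open>l\<close> is chosen to make both contributions equal.\<close>
lemma set_nn_integral_powr_le:
  fixes f :: "'a \<Rightarrow> real"
  assumes [measurable]: "f \<in> borel_measurable M" "A \<in> sets M" "E \<in> sets M"
    and E: "E \<subseteq> A" and q: "0 < q" "emeasure M E \<le> ennreal q * emeasure M A"
    and A: "emeasure M A \<noteq> 0" "emeasure M A \<noteq> \<infinity>" and r: "1 < r"
  shows "(\<integral>\<^sup>+x\<in>E. ennreal (f x) \<partial>M) \<le>
    2 * ennreal_root r ((\<integral>\<^sup>+x\<in>A. ennreal (f x powr r) \<partial>M) / emeasure M A) * emeasure M A * ennreal (q powr (1 - 1 / r))"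
proof -
  let ?X = "\<integral>\<^sup>+x\<in>A. ennreal (f x powr r) \<partial>M"
  consider "?X / emeasure M A = \<infinity>" | "?X = 0" | "?X / emeasure M A \<noteq> \<infinity>" "?X \<noteq> 0" by blast
  then show ?thesis
  proof cases
    case 1
    then have "2 * ennreal_root r (?X / emeasure M A) * emeasure M A * ennreal (q powr (1 - 1 / r)) = \<infinity>"
      using A q by (simp add: ennreal_root_def ennreal_mult_top ennreal_top_mult ennreal_mult_eq_top_iff)
    then show ?thesis by simp
  next
    case 2
    then have "AE x in M. ennreal (f x powr r) * indicator A x = 0"
      by (subst (asm) nn_integral_0_iff_AE) auto
    then have "AE x in M. ennreal (f x) * indicator E x = 0"
    proof eventually_elim
      case (elim x)
      show ?case
      proof (cases "x \<in> E \<and> 0 < f x")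
        case True
        then have "0 < f x powr r" "x \<in> A" using E by auto
        then show ?thesis using elim by (simp add: ennreal_eq_0_iff)
      qed (auto simp: not_less ennreal_neg split: split_indicator)
    qed
    then have "(\<integral>\<^sup>+x\<in>E. ennreal (f x) \<partial>M) = 0" by (subst nn_integral_0_iff_AE) auto
    then show ?thesis by simp
  next
    case 3
    obtain y where y: "?X / emeasure M A = ennreal y" "0 \<le> y"
      using 3(1) by (cases "?X / emeasure M A") auto
    have X: "?X = ennreal y * emeasure M A"
    proof -
      have "?X / emeasure M A * emeasure M A = ?X"
        using A by (simp add: ennreal_divide_times ennreal_times_divide[symmetric] ennreal_divide_self less_top)
      then show ?thesis by (simp add: y(1))
    qed
    have "y \<noteq> 0" using 3(2) X by auto
    then have y0: "0 < y" using y by simp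
    define a where "a = y powr (1 / r)"
    have a: "0 < a" "a powr r = y" using y0 r by (auto simp: a_def powr_powr)
    define l where "l = a * q powr (- (1 / r))"
    have l: "0 < l" using a q by (simp add: l_def)
    have lq: "l * q = a * q powr (1 - 1 / r)"
      using q by (simp add: l_def powr_diff powr_minus field_simps)
    have lr: "l powr (1 - r) * y = a * q powr (1 - 1 / r)"
    proof -
      have "l powr (1 - r) = a powr (1 - r) * (q powr (- (1 / r))) powr (1 - r)"
        using a q by (simp add: l_def powr_mult)
      also have "(q powr (- (1 / r))) powr (1 - r) = q powr (1 - 1 / r)"
      proof -
        have "(- (1 / r)) * (1 - r) = 1 - 1 / r" using r by (simp add: field_simps)
        then show ?thesis by (simp only: powr_powr)
      qed
      finally have "l powr (1 - r) * y = (a powr (1 - r) * a powr r) * q powr (1 - 1 / r)"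
        by (simp add: a mult_ac)
      also have "a powr (1 - r) * a powr r = a" using a(1) by (simp add: powr_add[symmetric])
      finally show ?thesis .
    qed
    have "(\<integral>\<^sup>+x\<in>E. ennreal (f x) \<partial>M)
        \<le> (\<integral>\<^sup>+x. ennreal l * indicator E x + ennreal (l powr (1 - r)) * (ennreal (f x powr r) * indicator A x) \<partial>M)"
    proof (intro nn_integral_mono)
      fix x
      show "ennreal (f x) * indicator E x
          \<le> ennreal l * indicator E x + ennreal (l powr (1 - r)) * (ennreal (f x powr r) * indicator A x)"
      proof (cases "x \<in> E \<and> 0 < f x")
        case True
        then have "ennreal (f x) \<le> ennreal (l + l powr (1 - r) * f x powr r)"
          using l r by (intro ennreal_leI powr_split) auto
        also have "\<dots> = ennreal l + ennreal (l powr (1 - r)) * ennreal (f x powr r)"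
          using l by (simp add: ennreal_mult)
        finally show ?thesis using True E by auto
      qed (auto simp: not_less ennreal_neg split: split_indicator)
    qed
    also have "\<dots> = ennreal l * emeasure M E + ennreal (l powr (1 - r)) * ?X"
      by (simp add: nn_integral_add nn_integral_cmult)
    also have "\<dots> \<le> ennreal l * (ennreal q * emeasure M A) + ennreal (l powr (1 - r)) * (ennreal y * emeasure M A)"
      unfolding X by (intro add_mono mult_left_mono q) auto
    also have "\<dots> = ennreal (l * q) * emeasure M A + ennreal (l powr (1 - r) * y) * emeasure M A"
      using l q y by (simp add: ennreal_mult mult.assoc)
    also have "\<dots> = 2 * ennreal a * emeasure M A * ennreal (q powr (1 - 1 / r))"
      unfolding lq lr using a q by (simp add: ennreal_mult mult_ac flip: mult_2)
    also have "ennreal a = ennreal_root r (?X / emeasure M A)"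
      using y by (simp add: ennreal_root_def a_def)
    finally show ?thesis .
  qed
qed

lemma ennreal_inverse_antimono: "a \<le> b \<Longrightarrow> inverse b \<le> inverse (a :: ennreal)"
  including ennreal.lifting by transfer (rule ereal_inverse_antimono)

text \<open>Pointwise in \<open>w\<close>, the kernel is dominated by the single term belonging to the dyadic tent around
  the Carleson tent through \<open>z\<close> and \<open>w\<close>. Integrating the sum over all tents against \<open>h\<close> produces the averages.\<close>
lemma kernel_sparse_domination:
  fixes \<D> :: "'n::finite dyadic_data set"
  assumes fin: "finite \<D>" and c: "0 \<le> c"
    and tree: "\<And>S. S \<in> \<D> \<Longrightarrow> tent_tree V (kube_index S) (dyadic_tent \<theta> S) fst \<rho>"
    and cov: "\<And>z. z \<in> unit_ball \<Longrightarrow> \<exists>S\<in>\<D>. \<exists>p\<in>kube_index S. carleson_tent z \<subseteq> dyadic_tent \<theta> S p \<and>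
           emeasure V (dyadic_tent \<theta> S p) \<le> ennreal c * emeasure V (carleson_tent z)"
  shows "\<exists>K>0. \<forall>z\<in>unit_ball. \<forall>h\<in>borel_measurable V.
     (\<integral>\<^sup>+w. h w * ennreal (1 / norm (1 - herm z w) ^ (CARD('n) + 1)) \<partial>V)
      \<le> ennreal K * (\<Sum>S\<in>\<D>. \<integral>\<^sup>+p. tent_tree.mean V (dyadic_tent \<theta> S) h p * indicator (dyadic_tent \<theta> S p) z
            \<partial>count_space (kube_index S))"
proof -
  let ?n = "CARD('n) + 1"
  obtain C where C: "1 \<le> C" and vol: "\<And>z. z \<in> unit_ball \<Longrightarrow>
      emeasure V (carleson_tent z) \<le> ennreal (C * (1 - norm (z :: complex ^ 'n)) ^ ?n)"
    using carleson_tent_volume[where 'n = 'n] by blast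
  define K where "K = (c + 1) * (C * 3 ^ ?n)"
  have K: "0 < K" using C c by (simp add: K_def add_nonneg_pos)
  let ?T = "dyadic_tent \<theta>"
  have pt: "ennreal (1 / norm (1 - herm z w) ^ ?n) \<le> ennreal K * (\<Sum>S\<in>\<D>. \<integral>\<^sup>+p. indicator (?T S p) z * indicator (?T S p) w / emeasure V (?T S p) \<partial>count_space (kube_index S))"
    if zw: "z \<in> unit_ball" "w \<in> unit_ball" for z w :: "complex ^ 'n"
  proof -
    define d where "d = norm (1 - herm z w)"
    have d: "0 < d" using norm_one_minus_herm_ge[OF zw] by (simp add: d_def)
    obtain \<zeta> where \<zeta>: "\<zeta> \<in> unit_ball" "z \<in> carleson_tent \<zeta>" "w \<in> carleson_tent \<zeta>" "1 - norm \<zeta> \<le> 3 * d"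
      using carleson_tent_through_points[OF zw] unfolding d_def by blast
    obtain S p where S: "S \<in> \<D>" "p \<in> kube_index S" "carleson_tent \<zeta> \<subseteq> ?T S p"
      "emeasure V (?T S p) \<le> ennreal c * emeasure V (carleson_tent \<zeta>)" using cov[OF \<zeta>(1)] by blast
    interpret tent_tree V "kube_index S" "?T S" fst \<rho> by (rule tree[OF S(1)])
    note S(4)
    also have "ennreal c * emeasure V (carleson_tent \<zeta>) \<le> ennreal c * ennreal (C * (1 - norm \<zeta>) ^ ?n)"
      by (intro mult_left_mono vol \<zeta>) auto
    also have "\<dots> = ennreal (c * (C * (1 - norm \<zeta>) ^ ?n))" using c C \<zeta>(1) by (subst ennreal_mult) auto
    also have "\<dots> \<le> ennreal ((c + 1) * (C * (3 * d) ^ ?n))"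
      using c C \<zeta> by (intro ennreal_leI mult_mono power_mono) auto
    also have "\<dots> = ennreal (K * d ^ ?n)" unfolding K_def power_mult_distrib by (simp only: mult_ac)
    finally have m: "emeasure V (?T S p) \<le> ennreal (K * d ^ ?n)" .
    have "ennreal (1 / d ^ ?n) = ennreal K / ennreal (K * d ^ ?n)"
      using K d by (subst divide_ennreal) auto
    also have "\<dots> \<le> ennreal K / emeasure V (?T S p)"
      unfolding divide_ennreal_def by (intro mult_left_mono ennreal_inverse_antimono m) auto
    also have "\<dots> = ennreal K * (indicator (?T S p) z * indicator (?T S p) w / emeasure V (?T S p))"
    proof -
      have "z \<in> ?T S p" "w \<in> ?T S p" using S(3) \<zeta>(2,3) by auto
      then show ?thesis by (simp add: divide_ennreal_def)
    qed
    also have "\<dots> \<le> ennreal K * (\<integral>\<^sup>+p. indicator (?T S p) z * indicator (?T S p) w / emeasure V (?T S p) \<partial>count_space (kube_index S))"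
      by (intro mult_left_mono nn_integral_ge_point S) auto
    also have "\<dots> \<le> ennreal K * (\<Sum>S\<in>\<D>. \<integral>\<^sup>+p. indicator (?T S p) z * indicator (?T S p) w / emeasure V (?T S p) \<partial>count_space (kube_index S))"
      by (intro mult_left_mono member_le_sum[OF S(1)] fin) auto
    finally show ?thesis by (simp add: d_def)
  qed
  have "(\<integral>\<^sup>+w. h w * ennreal (1 / norm (1 - herm z w) ^ ?n) \<partial>V)
      \<le> ennreal K * (\<Sum>S\<in>\<D>. \<integral>\<^sup>+p. tent_tree.mean V (?T S) h p * indicator (?T S p) z \<partial>count_space (kube_index S))"
    if z: "z \<in> unit_ball" and h [measurable]: "h \<in> borel_measurable V" for z :: "complex ^ 'n" and h
  proof -
    let ?F = "\<lambda>S w p. h w * (indicator (?T S p) z * indicator (?T S p) w / emeasure V (?T S p)) :: ennreal"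
    have inner: "(\<lambda>w. \<integral>\<^sup>+p. ?F S w p \<partial>count_space (kube_index S)) \<in> borel_measurable V \<and>
        (\<integral>\<^sup>+w. (\<integral>\<^sup>+p. ?F S w p \<partial>count_space (kube_index S)) \<partial>V)
        = (\<integral>\<^sup>+p. tent_tree.mean V (?T S) h p * indicator (?T S p) z \<partial>count_space (kube_index S))"
      if S: "S \<in> \<D>" for S
    proof -
      interpret tent_tree V "kube_index S" "?T S" fst \<rho> by (rule tree[OF S])
      have F [measurable]: "(\<lambda>w. ?F S w p) \<in> borel_measurable V" if "p \<in> kube_index S" for p
        using that by measurable
      have "(\<lambda>w. \<integral>\<^sup>+p. ?F S w p \<partial>count_space (kube_index S)) \<in> borel_measurable V"
        unfolding count_space_eq_SUP by (intro borel_measurable_SUP borel_measurable_sum F) auto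
      moreover have "(\<integral>\<^sup>+w. (\<integral>\<^sup>+p. ?F S w p \<partial>count_space (kube_index S)) \<partial>V)
          = (\<integral>\<^sup>+p. (\<integral>\<^sup>+w. ?F S w p \<partial>V) \<partial>count_space (kube_index S))"
        by (rule nn_integral_count_space_nn_integral) (use F in auto)
      moreover have "(\<integral>\<^sup>+p. (\<integral>\<^sup>+w. ?F S w p \<partial>V) \<partial>count_space (kube_index S))
          = (\<integral>\<^sup>+p. mean h p * indicator (?T S p) z \<partial>count_space (kube_index S))"
      proof (intro nn_integral_cong)
        fix p assume "p \<in> space (count_space (kube_index S))"
        then have p: "p \<in> kube_index S" by simp
        have "(\<integral>\<^sup>+w. ?F S w p \<partial>V) = (\<integral>\<^sup>+w. (indicator (?T S p) z / emeasure V (?T S p)) * (h w * indicator (?T S p) w) \<partial>V)"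
          by (intro nn_integral_cong) (simp add: divide_ennreal_def mult_ac)
        also have "\<dots> = mean h p * indicator (?T S p) z"
          using p by (subst nn_integral_cmult) (auto simp: mean_def divide_ennreal_def mult_ac)
        finally show "(\<integral>\<^sup>+w. ?F S w p \<partial>V) = mean h p * indicator (?T S p) z" .
      qed
      ultimately show ?thesis by simp
    qed
    have "(\<integral>\<^sup>+w. h w * ennreal (1 / norm (1 - herm z w) ^ ?n) \<partial>V)
        \<le> (\<integral>\<^sup>+w. ennreal K * (\<Sum>S\<in>\<D>. \<integral>\<^sup>+p. ?F S w p \<partial>count_space (kube_index S)) \<partial>V)"
    proof (intro nn_integral_mono)
      fix w :: "complex ^ 'n" assume "w \<in> space V"
      then have w: "w \<in> unit_ball" by simp
      have "h w * ennreal (1 / norm (1 - herm z w) ^ ?n)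
        \<le> h w * (ennreal K * (\<Sum>S\<in>\<D>. \<integral>\<^sup>+p. indicator (?T S p) z * indicator (?T S p) w / emeasure V (?T S p) \<partial>count_space (kube_index S)))"
        by (intro mult_left_mono pt z w) auto
      also have "\<dots> = ennreal K * (\<Sum>S\<in>\<D>. \<integral>\<^sup>+p. ?F S w p \<partial>count_space (kube_index S))"
        by (simp add: nn_integral_cmult sum_distrib_left mult.left_commute)
      finally show "h w * ennreal (1 / norm (1 - herm z w) ^ ?n) \<le> ennreal K * (\<Sum>S\<in>\<D>. \<integral>\<^sup>+p. ?F S w p \<partial>count_space (kube_index S))" .
    qed
    also have "\<dots> = ennreal K * (\<Sum>S\<in>\<D>. \<integral>\<^sup>+w. (\<integral>\<^sup>+p. ?F S w p \<partial>count_space (kube_index S)) \<partial>V)"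
      using inner by (subst nn_integral_cmult) (auto intro!: borel_measurable_sum simp: nn_integral_sum)
    also have "\<dots> = ennreal K * (\<Sum>S\<in>\<D>. \<integral>\<^sup>+p. tent_tree.mean V (?T S) h p * indicator (?T S p) z \<partial>count_space (kube_index S))"
      using inner by simp
    finally show ?thesis .
  qed
  then show ?thesis using K by blast
qed

section \<open>The weak-type bound for Toeplitz operators\<close>

lemma herm_measurable:
  fixes a b :: "'a \<Rightarrow> complex ^ 'n::finite"
  assumes "\<And>j. (\<lambda>x. a x $ j) \<in> borel_measurable N" "\<And>j. (\<lambda>x. b x $ j) \<in> borel_measurable N"
  shows "(\<lambda>x. herm (a x) (b x)) \<in> borel_measurable N"
proof -
  have [measurable]: "cnj \<in> borel_measurable borel"
    by (intro borel_measurable_continuous_onI continuous_intros)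
  show ?thesis unfolding herm_def using assms by measurable
qed

lemma component_measurable_V [measurable]: "(\<lambda>x. x $ j) \<in> borel_measurable V"
  by (intro borel_measurable_V borel_measurable_continuous_onI continuous_intros)

lemma toeplitz_integrand_measurable:
  assumes [measurable]: "u \<in> borel_measurable V" "f \<in> borel_measurable V"
  shows "toeplitz_integrand u f z \<in> borel_measurable V"
proof -
  have [measurable]: "(\<lambda>w. herm z w) \<in> borel_measurable V"
    by (intro herm_measurable) auto
  show ?thesis unfolding toeplitz_integrand_def[abs_def] by measurable
qed

lemma toeplitz_measurable:
  fixes u f :: "complex ^ 'n::finite \<Rightarrow> complex"
  assumes [measurable]: "u \<in> borel_measurable V" "f \<in> borel_measurable V"
  shows "toeplitz u f \<in> borel_measurable V"
proof -
  have [measurable]: "(\<lambda>x :: (complex ^ 'n) \<times> (complex ^ 'n). herm (fst x) (snd x)) \<in> borel_measurable (V \<Otimes>\<^sub>M V)"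
    by (intro herm_measurable) measurable
  have "(\<lambda>(z, w). toeplitz_integrand u f z w) \<in> borel_measurable (V \<Otimes>\<^sub>M V)"
    unfolding toeplitz_integrand_def case_prod_beta by measurable
  then show ?thesis unfolding toeplitz_def[abs_def] by (rule V.borel_measurable_lebesgue_integral)
qed

lemma norm_toeplitz_le:
  "ennreal (norm (toeplitz u f z)) \<le>
     (\<integral>\<^sup>+w. ennreal (norm (u w)) * ennreal (norm (f w)) * ennreal (1 / norm (1 - herm z w) ^ (CARD('n) + 1)) \<partial>V)"
  for z :: "complex ^ 'n::finite"
proof -
  have "ennreal (norm (toeplitz u f z)) \<le> (\<integral>\<^sup>+w. ennreal (norm (toeplitz_integrand u f z w)) \<partial>V)"
  proof (cases "integrable V (toeplitz_integrand u f z)")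
    case True
    then show ?thesis unfolding toeplitz_def by (rule integral_norm_bound_ennreal)
  qed (simp add: toeplitz_def not_integrable_integral_eq)
  also have "\<dots> = (\<integral>\<^sup>+w. ennreal (norm (u w)) * ennreal (norm (f w)) * ennreal (1 / norm (1 - herm z w) ^ (CARD('n) + 1)) \<partial>V)"
  proof (rule nn_integral_cong)
    fix w
    have "norm (toeplitz_integrand u f z w) = norm (u w) * norm (f w) * (1 / norm (1 - herm z w) ^ (CARD('n) + 1))"
      by (simp add: toeplitz_integrand_def norm_mult norm_divide norm_power del: power_Suc)
    then show "ennreal (norm (toeplitz_integrand u f z w)) =
        ennreal (norm (u w)) * ennreal (norm (f w)) * ennreal (1 / norm (1 - herm z w) ^ (CARD('n) + 1))"
      by (simp only: ennreal_mult norm_ge_zero mult_nonneg_nonneg zero_le_divide_1_iff zero_le_power)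
  qed
  finally show ?thesis .
qed

lemma AE_le_sup_norm_on:
  assumes "A \<in> sets V"
  shows "AE x in V. x \<in> A \<longrightarrow> g x \<le> sup_norm_on A g"
proof -
  have A: "A \<inter> space V \<in> sets V" using assms by (rule sets.Int_space_eq2[THEN ssubst]) (rule assms)
  show ?thesis
    using esssup_AE[of g "restrict_space V A"] unfolding sup_norm_on_def by (simp only: AE_restrict_space_iff[OF A])
qed

text \<open>After scaling \<open>|u f|\<close> by \<open>k = K m / t\<close>, where \<open>m\<close> is the number of dyadic structures, a value of
  \<open>T f\<close> above \<open>t\<close> forces the sum of averages over one of the structures above 1. One factor \<open>m\<close> of the
  constant comes from this scaling and the other from adding up the structures.\<close>
lemma weak_type_toeplitz:
  fixes \<D> :: "'n::finite dyadic_data set" and u f :: "complex ^ 'n \<Rightarrow> complex"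
  assumes fin: "finite \<D>" "\<D> \<noteq> {}"
    and tree: "\<And>S. S \<in> \<D> \<Longrightarrow> tent_tree V (kube_index S) (dyadic_tent \<theta> S) fst \<rho>"
    and K: "0 < K" and sparse_dom: "\<And>z h. z \<in> unit_ball \<Longrightarrow> h \<in> borel_measurable V \<Longrightarrow>
     (\<integral>\<^sup>+w. h w * ennreal (1 / norm (1 - herm z w) ^ (CARD('n) + 1)) \<partial>V)
      \<le> ennreal K * (\<Sum>S\<in>\<D>. \<integral>\<^sup>+p. tent_tree.mean V (dyadic_tent \<theta> S) h p * indicator (dyadic_tent \<theta> S p) z
            \<partial>count_space (kube_index S))"
    and N: "\<rho> ^ N \<le> 1/2" and r: "1 < r"
    and meas [measurable]: "u \<in> borel_measurable V" "f \<in> borel_measurable V" "\<sigma> \<in> borel_measurable V"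
    and R: "\<And>A. A \<in> tents \<theta> \<D> \<Longrightarrow> ennreal_root r (avg (\<lambda>x. \<sigma> x powr r) A) \<le> R * avg \<sigma> A"
    and B: "\<And>A. A \<in> tents \<theta> \<D> \<Longrightarrow> AE x in V. x \<in> A \<longrightarrow> avg \<sigma> A * ennreal (norm (u x)) \<le> B * ennreal (\<sigma> x)"
  shows "weak_L1_norm \<sigma> (toeplitz u f) \<le>
     ennreal (2 * K * (card \<D>)\<^sup>2 * (1 + 8 * real N * (6 + real N)) * (1 + ln (r / (r - 1)))) * (B * R) * L1_norm \<sigma> f"
  unfolding weak_L1_norm_def
proof (rule SUP_least)
  fix t :: real assume "t \<in> {0<..}"
  then have t: "0 < t" by simp
  define m where "m = real (card \<D>)"
  have m: "0 < m" using fin by (simp add: m_def card_gt_0_iff)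
  define k where "k = K * m / t"
  have k: "0 < k" using K m t by (simp add: k_def)
  define W where "W = (1 + 8 * real N * (6 + real N)) * (1 + ln (r / (r - 1)))"
  have W: "0 \<le> W" using r unfolding W_def by (intro mult_nonneg_nonneg add_nonneg_nonneg) auto
  define h where "h w = ennreal (norm (u w)) * ennreal (norm (f w))" for w
  define g where "g w = ennreal k * h w" for w
  define G where "G w = ennreal k * (2 * (B * R)) * (ennreal (norm (f w)) * ennreal (\<sigma> w))" for w
  have [measurable]: "h \<in> borel_measurable V" "g \<in> borel_measurable V" "G \<in> borel_measurable V"
    unfolding h_def g_def G_def by measurable
  define X where "X S z = (\<integral>\<^sup>+p. tent_tree.mean V (dyadic_tent \<theta> S) g p * indicator (dyadic_tent \<theta> S p) z \<partial>count_space (kube_index S))" for S z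
  have intG: "(\<integral>\<^sup>+w. G w \<partial>V) = ennreal k * (2 * (B * R)) * L1_norm \<sigma> f"
    unfolding G_def L1_norm_def by (rule nn_integral_cmult) measurable
  have part: "(\<integral>\<^sup>+x\<in>{x\<in>space V. 1 < X S x}. ennreal (\<sigma> x) \<partial>V) \<le> ennreal W * (\<integral>\<^sup>+w. G w \<partial>V)" if S: "S \<in> \<D>" for S
  proof -
    interpret tent_tree V "kube_index S" "dyadic_tent \<theta> S" fst \<rho> by (rule tree[OF S])
    define a where "a p = 2 * ennreal_root r (avg (\<lambda>x. \<sigma> x powr r) (dyadic_tent \<theta> S p))" for p
    have p1: "1 \<le> r / (r - 1)" using r by simp
    have p2: "1 / (r / (r - 1)) = 1 - 1 / r" using r by (simp add: field_simps)
    show ?thesis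
      unfolding X_def W_def
    proof (rule weak_type[where a = a, OF N p1])
      fix p assume p: "p \<in> kube_index S"
      then have A: "dyadic_tent \<theta> S p \<in> tents \<theta> \<D>" using S by (auto simp: tents_def)
      show "AE x in V. x \<in> dyadic_tent \<theta> S p \<longrightarrow> a p * g x \<le> G x"
        using B[OF A]
      proof eventually_elim
        case (elim x)
        show ?case
        proof
          assume "x \<in> dyadic_tent \<theta> S p"
          then have le: "avg \<sigma> (dyadic_tent \<theta> S p) * ennreal (norm (u x)) \<le> B * ennreal (\<sigma> x)" using elim by simp
          have "a p * g x \<le> 2 * (R * avg \<sigma> (dyadic_tent \<theta> S p)) * g x"
            unfolding a_def by (intro mult_right_mono mult_left_mono R A) auto
          also have "\<dots> = ennreal k * (2 * R) * ennreal (norm (f x)) * (avg \<sigma> (dyadic_tent \<theta> S p) * ennreal (norm (u x)))"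
            by (simp add: g_def h_def mult_ac)
          also have "\<dots> \<le> ennreal k * (2 * R) * ennreal (norm (f x)) * (B * ennreal (\<sigma> x))"
            by (intro mult_left_mono le) auto
          also have "\<dots> = G x" by (simp add: G_def mult_ac)
          finally show "a p * g x \<le> G x" .
        qed
      qed
      fix E q assume E: "E \<in> sets V" "E \<subseteq> dyadic_tent \<theta> S p" "0 < q"
        "emeasure V E \<le> ennreal q * emeasure V (dyadic_tent \<theta> S p)"
      show "(\<integral>\<^sup>+x\<in>E. ennreal (\<sigma> x) \<partial>V) \<le> a p * emeasure V (dyadic_tent \<theta> S p) * ennreal (q powr (1 / (r / (r - 1))))"
        unfolding p2 a_def avg_def using p E r tent_pos[OF p] tent_fin[OF p]
        by (intro set_nn_integral_powr_le) auto
    qed measurable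
  qed
  have cover: "\<exists>S\<in>\<D>. 1 < X S z" if z: "z \<in> unit_ball" "t < norm (toeplitz u f z)" for z
  proof (rule ccontr)
    assume "\<not> (\<exists>S\<in>\<D>. 1 < X S z)"
    then have "(\<Sum>S\<in>\<D>. X S z) \<le> (\<Sum>S\<in>\<D>. 1)" by (intro sum_mono) (auto simp: not_less)
    then have le: "(\<Sum>S\<in>\<D>. X S z) \<le> ennreal m" by (simp add: m_def ennreal_of_nat_eq_real_of_nat)
    have "ennreal k * ennreal (norm (toeplitz u f z)) \<le>
        ennreal k * (\<integral>\<^sup>+w. h w * ennreal (1 / norm (1 - herm z w) ^ (CARD('n) + 1)) \<partial>V)"
      unfolding h_def by (intro mult_left_mono norm_toeplitz_le) auto
    also have "\<dots> = (\<integral>\<^sup>+w. ennreal k * (h w * ennreal (1 / norm (1 - herm z w) ^ (CARD('n) + 1))) \<partial>V)"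
    proof (rule nn_integral_cmult[symmetric])
      have [measurable]: "(\<lambda>w. herm z w) \<in> borel_measurable V" by (intro herm_measurable) auto
      show "(\<lambda>w. h w * ennreal (1 / norm (1 - herm z w) ^ (CARD('n) + 1))) \<in> borel_measurable V" by measurable
    qed
    also have "\<dots> = (\<integral>\<^sup>+w. g w * ennreal (1 / norm (1 - herm z w) ^ (CARD('n) + 1)) \<partial>V)"
      by (simp add: g_def mult.assoc)
    also have "\<dots> \<le> ennreal K * (\<Sum>S\<in>\<D>. X S z)"
      unfolding X_def by (intro sparse_dom z) measurable
    also have "\<dots> \<le> ennreal K * ennreal m" by (intro mult_left_mono le) auto
    finally have "k * norm (toeplitz u f z) \<le> K * m"
      using k K m by (simp add: ennreal_mult[symmetric])
    then have "norm (toeplitz u f z) \<le> t" using K m t by (simp add: k_def field_simps)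
    then show False using z by simp
  qed
  have "wmeasure \<sigma> {z \<in> unit_ball. t < norm (toeplitz u f z)}
      \<le> (\<integral>\<^sup>+x. (\<Sum>S\<in>\<D>. ennreal (\<sigma> x) * indicator {x\<in>space V. 1 < X S x} x) \<partial>V)"
    unfolding wmeasure_def
  proof (rule nn_integral_mono)
    fix x :: "complex ^ 'n" assume x: "x \<in> space V"
    show "ennreal (\<sigma> x) * indicator {z \<in> unit_ball. t < norm (toeplitz u f z)} x
        \<le> (\<Sum>S\<in>\<D>. ennreal (\<sigma> x) * indicator {x\<in>space V. 1 < X S x} x)"
    proof (cases "t < norm (toeplitz u f x)")
      case True
      then obtain S where S: "S \<in> \<D>" "1 < X S x" using cover x by auto
      then have "ennreal (\<sigma> x) \<le> ennreal (\<sigma> x) * indicator {x\<in>space V. 1 < X S x} x" using x by simp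
      also have "\<dots> \<le> (\<Sum>S\<in>\<D>. ennreal (\<sigma> x) * indicator {x\<in>space V. 1 < X S x} x)"
        by (rule member_le_sum[OF S(1)]) (use fin in auto)
      finally show ?thesis using True x by simp
    qed simp
  qed
  also have "\<dots> = (\<Sum>S\<in>\<D>. \<integral>\<^sup>+x\<in>{x\<in>space V. 1 < X S x}. ennreal (\<sigma> x) \<partial>V)"
  proof (rule nn_integral_sum)
    fix S assume S: "S \<in> \<D>"
    interpret tent_tree V "kube_index S" "dyadic_tent \<theta> S" fst \<rho> by (rule tree[OF S])
    have [measurable]: "X S \<in> borel_measurable V"
      unfolding X_def count_space_eq_SUP
    proof (intro borel_measurable_SUP borel_measurable_sum)
      fix n p assume "p \<in> {i \<in> kube_index S. to_nat_on (kube_index S) i < n}"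
      then have [measurable]: "dyadic_tent \<theta> S p \<in> sets V" by simp
      show "(\<lambda>z. mean g p * indicator (dyadic_tent \<theta> S p) z) \<in> borel_measurable V" by measurable
    qed auto
    show "(\<lambda>x. ennreal (\<sigma> x) * indicator {x\<in>space V. 1 < X S x} x) \<in> borel_measurable V" by measurable
  qed
  also have "\<dots> \<le> (\<Sum>S\<in>\<D>. ennreal W * (\<integral>\<^sup>+w. G w \<partial>V))" by (intro sum_mono part)
  also have "\<dots> = ennreal m * (ennreal W * (\<integral>\<^sup>+w. G w \<partial>V))"
    by (simp add: m_def ennreal_of_nat_eq_real_of_nat)
  finally have "ennreal t * wmeasure \<sigma> {z \<in> unit_ball. t < norm (toeplitz u f z)}
     \<le> ennreal t * (ennreal m * (ennreal W * (\<integral>\<^sup>+w. G w \<partial>V)))" by (intro mult_left_mono) auto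
  also have "\<dots> = (ennreal t * ennreal m * ennreal W * ennreal k * ennreal 2) * (B * R) * L1_norm \<sigma> f"
    by (simp add: intG mult_ac)
  also have "ennreal t * ennreal m * ennreal W * ennreal k * ennreal 2 = ennreal (t * m * W * k * 2)"
    using t m W k by (simp add: ennreal_mult del: ennreal_numeral)
  also have "t * m * W * k * 2 = 2 * K * (card \<D>)\<^sup>2 * (1 + 8 * real N * (6 + real N)) * (1 + ln (r / (r - 1)))"
    using t by (simp add: k_def W_def m_def power2_eq_square)
  finally show "ennreal t * wmeasure \<sigma> {z \<in> unit_ball. t < norm (toeplitz u f z)}
    \<le> ennreal (2 * K * (card \<D>)\<^sup>2 * (1 + 8 * real N * (6 + real N)) * (1 + ln (r / (r - 1)))) * (B * R) * L1_norm \<sigma> f" .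
qed

lemma avg_pos:
  assumes \<sigma>: "weight \<sigma>" and A: "A \<in> sets V" "emeasure V A \<noteq> 0"
  shows "avg \<sigma> A \<noteq> 0"
proof
  have [measurable]: "\<sigma> \<in> borel_measurable V" "A \<in> sets V" using \<sigma> A by (auto simp: weight_def)
  assume "avg \<sigma> A = 0"
  then have "(\<integral>\<^sup>+x\<in>A. ennreal (\<sigma> x) \<partial>V) = 0" by (simp add: avg_def ennreal_divide_eq_0_iff)
  then have "AE x in V. ennreal (\<sigma> x) * indicator A x = 0" by (subst (asm) nn_integral_0_iff_AE) auto
  moreover have "AE x in V. 0 < \<sigma> x" using \<sigma> by (simp add: weight_def)
  ultimately have "AE x in V. x \<notin> A" by eventually_elim (auto split: split_indicator_asm)
  then have "A \<in> null_sets V" using A AE_iff_null_sets by blast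
  then show False using A by auto
qed

lemma avg_times_u_le:
  assumes \<sigma>: "weight \<sigma>" and A: "A \<in> tents \<theta> \<D>" "A \<in> sets V"
  shows "AE x in V. x \<in> A \<longrightarrow> avg \<sigma> A * ennreal (norm (u x)) \<le> uB1_char \<theta> \<D> u \<sigma> * ennreal (\<sigma> x)"
proof -
  let ?U = "sup_norm_on A (\<lambda>x. ennreal (norm (u x)))" and ?L = "sup_norm_on A (\<lambda>x. inverse (ennreal (\<sigma> x)))"
  have B: "?U * avg \<sigma> A * ?L \<le> uB1_char \<theta> \<D> u \<sigma>"
    unfolding uB1_char_def by (rule SUP_upper[OF A(1)])
  have "AE x in V. 0 < \<sigma> x" using \<sigma> by (simp add: weight_def)
  then show ?thesis
    using AE_le_sup_norm_on[OF A(2), of "\<lambda>x. ennreal (norm (u x))"] AE_le_sup_norm_on[OF A(2), of "\<lambda>x. inverse (ennreal (\<sigma> x))"]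
  proof eventually_elim
    case (elim x)
    show ?case
    proof
      assume x: "x \<in> A"
      have inv: "inverse (ennreal (\<sigma> x)) * ennreal (\<sigma> x) = 1"
        using elim(1) by (simp add: inverse_ennreal ennreal_mult[symmetric])
      have "avg \<sigma> A * ennreal (norm (u x)) = ennreal (norm (u x)) * avg \<sigma> A * (inverse (ennreal (\<sigma> x)) * ennreal (\<sigma> x))"
        unfolding inv by (simp add: mult.commute)
      also have "\<dots> \<le> ?U * avg \<sigma> A * (?L * ennreal (\<sigma> x))"
        using elim x by (intro mult_mono) auto
      also have "\<dots> \<le> uB1_char \<theta> \<D> u \<sigma> * ennreal (\<sigma> x)"
        unfolding mult.assoc[symmetric] by (intro mult_right_mono B) auto
      finally show "avg \<sigma> A * ennreal (norm (u x)) \<le> uB1_char \<theta> \<D> u \<sigma> * ennreal (\<sigma> x)" .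
    qed
  qed
qed

text \<open>None of the three factors of the term of \<open>uB1_char\<close> for the whole ball is 0, so none can be
  infinite if the product is to be finite.\<close>
lemma nondegenerate_weight:
  assumes \<sigma>: "weight \<sigma>" and ball: "unit_ball \<in> tents \<theta> \<D>"
    and fin: "uB1_char \<theta> \<D> u \<sigma> < \<infinity>" and u: "\<not> (AE x in V. u x = 0)"
  shows "avg \<sigma> (unit_ball :: (complex ^ 'n::finite) set) \<noteq> \<infinity>"
    "sup_norm_on (unit_ball :: (complex ^ 'n) set) (\<lambda>x. inverse (ennreal (\<sigma> x))) \<noteq> \<infinity>"
proof -
  let ?A = "unit_ball :: (complex ^ 'n) set"
  let ?U = "sup_norm_on ?A (\<lambda>x. ennreal (norm (u x)))" and ?L = "sup_norm_on ?A (\<lambda>x. inverse (ennreal (\<sigma> x)))"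
  have A: "?A \<in> sets V" by (intro borel_imp_sets_V) auto
  have one: "emeasure V ?A = 1" using V.emeasure_space_1 by simp
  have "?U * avg \<sigma> ?A * ?L \<le> uB1_char \<theta> \<D> u \<sigma>"
    unfolding uB1_char_def by (rule SUP_upper[OF ball])
  then have prod: "?U * avg \<sigma> ?A * ?L < \<infinity>" using fin by (rule le_less_trans)
  have U0: "?U \<noteq> 0"
  proof
    assume "?U = 0"
    then have "AE x in V. x \<in> ?A \<longrightarrow> ennreal (norm (u x)) \<le> 0"
      using AE_le_sup_norm_on[OF A, of "\<lambda>x. ennreal (norm (u x))"] by simp
    then have "AE x in V. u x = 0" using AE_space[of V] by eventually_elim auto
    then show False using u by simp
  qed
  have L0: "?L \<noteq> 0"
  proof
    assume "?L = 0"
    then have "AE x in V. x \<in> ?A \<longrightarrow> inverse (ennreal (\<sigma> x)) \<le> 0"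
      using AE_le_sup_norm_on[OF A, of "\<lambda>x. inverse (ennreal (\<sigma> x))"] by simp
    then have "AE x in (V :: (complex ^ 'n) measure). False" using AE_space[of V] by eventually_elim auto
    then show False using V.AE_False by simp
  qed
  have a0: "avg \<sigma> ?A \<noteq> 0" using one by (intro avg_pos \<sigma> A) simp
  show "avg \<sigma> ?A \<noteq> \<infinity>"
  proof
    assume "avg \<sigma> ?A = \<infinity>"
    then have "?U * avg \<sigma> ?A * ?L = \<infinity>" using U0 L0 by (simp add: ennreal_mult_top ennreal_top_mult)
    then show False using prod by simp
  qed
  show "?L \<noteq> \<infinity>"
  proof
    assume "?L = \<infinity>"
    then have "?U * avg \<sigma> ?A * ?L = \<infinity>" using U0 a0 by (simp add: ennreal_mult_top ennreal_top_mult)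
    then show False using prod by simp
  qed
qed

text \<open>Clearing the denominator in \<open>RH_char\<close> requires an average that is neither 0 nor infinite.\<close>
lemma reverse_holder_tent:
  assumes \<sigma>: "weight \<sigma>" and A: "A \<in> tents \<theta> \<D>" "A \<in> sets V" "emeasure V A \<noteq> 0"
    and ball: "avg \<sigma> (unit_ball :: (complex ^ 'n::finite) set) \<noteq> \<infinity>"
  shows "ennreal_root r (avg (\<lambda>x. \<sigma> x powr r) A) \<le> RH_char \<theta> \<D> r \<sigma> * avg \<sigma> (A :: (complex ^ 'n) set)"
proof -
  have [measurable]: "\<sigma> \<in> borel_measurable V" "A \<in> sets V" using \<sigma> A by (auto simp: weight_def)
  have one: "emeasure V (unit_ball :: (complex ^ 'n) set) = 1" using V.emeasure_space_1[where 'n = 'n] by simp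
  have "(\<integral>\<^sup>+x\<in>A. ennreal (\<sigma> x) \<partial>V) \<le> (\<integral>\<^sup>+x\<in>unit_ball. ennreal (\<sigma> x) \<partial>V)"
    using A by (intro nn_integral_mono) (auto simp: sets_V_iff split: split_indicator)
  also have "\<dots> = avg \<sigma> unit_ball" by (simp add: avg_def one divide_ennreal_def)
  also have "\<dots> < \<infinity>" using ball by (simp add: less_top)
  finally have "avg \<sigma> A \<noteq> \<infinity>" using A(3) by (auto simp: avg_def ennreal_divide_eq_top_iff)
  then have eq: "ennreal_root r (avg (\<lambda>x. \<sigma> x powr r) A) = ennreal_root r (avg (\<lambda>x. \<sigma> x powr r) A) / avg \<sigma> A * avg \<sigma> A"
    using avg_pos[OF \<sigma> A(2,3)]
    by (simp add: ennreal_divide_times ennreal_times_divide[symmetric] ennreal_divide_self less_top)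
  show ?thesis
    by (subst eq) (intro mult_right_mono, auto simp: RH_char_def intro: SUP_upper[OF A(1)])
qed

text \<open>The kernel is bounded for fixed \<open>z\<close>, and \<open>f\<close> is integrable because the inverse of the weight is
  essentially bounded.\<close>
lemma toeplitz_integrand_integrable:
  fixes u f :: "complex ^ 'n::finite \<Rightarrow> complex"
  assumes u: "u \<in> L_infinity" and \<sigma>: "weight \<sigma>" and f: "f \<in> L1 \<sigma>" and z: "z \<in> unit_ball"
    and L: "sup_norm_on (unit_ball :: (complex ^ 'n) set) (\<lambda>x. inverse (ennreal (\<sigma> x))) \<noteq> \<infinity>"
  shows "integrable V (toeplitz_integrand u f z)"
proof (rule integrableI_bounded)
  have [measurable]: "u \<in> borel_measurable V" "f \<in> borel_measurable V" "\<sigma> \<in> borel_measurable V"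
    using u f \<sigma> by (auto simp: L_infinity_def L1_def weight_def)
  then show "toeplitz_integrand u f z \<in> borel_measurable V" by (intro toeplitz_integrand_measurable)
  let ?A = "unit_ball :: (complex ^ 'n) set"
  let ?U = "sup_norm_on ?A (\<lambda>x. ennreal (norm (u x)))" and ?L = "sup_norm_on ?A (\<lambda>x. inverse (ennreal (\<sigma> x)))"
  let ?c = "ennreal (1 / (1 - norm z) ^ (CARD('n) + 1))"
  have A: "?A \<in> sets V" by (intro borel_imp_sets_V) auto
  have "AE x in V. 0 < \<sigma> x" using \<sigma> by (simp add: weight_def)
  then have "AE w in V. ennreal (norm (toeplitz_integrand u f z w)) \<le> ?c * ?U * ?L * (ennreal (norm (f w)) * ennreal (\<sigma> w))"
    using AE_le_sup_norm_on[OF A, of "\<lambda>x. ennreal (norm (u x))"] AE_le_sup_norm_on[OF A, of "\<lambda>x. inverse (ennreal (\<sigma> x))"]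
      AE_space[of V]
  proof eventually_elim
    case (elim w)
    then have w: "w \<in> ?A" by simp
    have inv: "inverse (ennreal (\<sigma> w)) * ennreal (\<sigma> w) = 1"
      using elim(1) by (simp add: inverse_ennreal ennreal_mult[symmetric])
    have d: "(1 - norm z) ^ (CARD('n) + 1) \<le> norm (1 - herm z w) ^ (CARD('n) + 1)"
      using norm_one_minus_herm_ge(1)[OF z w] z by (intro power_mono) auto
    have d0: "0 < (1 - norm z) ^ (CARD('n) + 1)" using z by simp
    have "norm (toeplitz_integrand u f z w) = norm (u w) * norm (f w) * (1 / norm (1 - herm z w) ^ (CARD('n) + 1))"
      by (simp add: toeplitz_integrand_def norm_mult norm_divide norm_power del: power_Suc)
    also have "\<dots> \<le> norm (u w) * norm (f w) * (1 / (1 - norm z) ^ (CARD('n) + 1))"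
      using d d0 by (intro mult_left_mono divide_left_mono) auto
    finally have "ennreal (norm (toeplitz_integrand u f z w)) \<le> ennreal (norm (u w) * norm (f w) * (1 / (1 - norm z) ^ (CARD('n) + 1)))"
      by (rule ennreal_leI)
    also have "\<dots> = ?c * ennreal (norm (u w)) * ennreal (norm (f w))"
      using d0 by (subst ennreal_mult, simp, simp, subst ennreal_mult) (auto simp: mult_ac)
    also have "\<dots> = ?c * ennreal (norm (u w)) * inverse (ennreal (\<sigma> w)) * (ennreal (norm (f w)) * ennreal (\<sigma> w))"
    proof -
      have "?c * ennreal (norm (u w)) * ennreal (norm (f w))
          = ?c * ennreal (norm (u w)) * ennreal (norm (f w)) * (inverse (ennreal (\<sigma> w)) * ennreal (\<sigma> w))"
        unfolding inv by simp
      then show ?thesis by (simp only: mult_ac)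
    qed
    also have "\<dots> \<le> ?c * ?U * ?L * (ennreal (norm (f w)) * ennreal (\<sigma> w))"
      using elim w by (intro mult_mono) auto
    finally show ?case .
  qed
  then have "(\<integral>\<^sup>+w. ennreal (norm (toeplitz_integrand u f z w)) \<partial>V)
      \<le> (\<integral>\<^sup>+w. ?c * ?U * ?L * (ennreal (norm (f w)) * ennreal (\<sigma> w)) \<partial>V)"
    by (rule nn_integral_mono_AE)
  also have "\<dots> = ?c * ?U * ?L * L1_norm \<sigma> f"
    unfolding L1_norm_def by (rule nn_integral_cmult) measurable
  also have "\<dots> < \<infinity>"
    using u f L by (auto simp: L_infinity_def L1_def ennreal_mult_less_top less_top)
  finally show "(\<integral>\<^sup>+w. ennreal (norm (toeplitz_integrand u f z w)) \<partial>V) < \<infinity>" .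
qed

lemma toeplitz_bounded_if_weak_bound:
  fixes u :: "complex ^ 'n::finite \<Rightarrow> complex"
  assumes u: "u \<in> borel_measurable V"
    and int: "\<And>f z. f \<in> L1 \<sigma> \<Longrightarrow> z \<in> unit_ball \<Longrightarrow> integrable V (toeplitz_integrand u f z)"
    and bound: "\<And>f. f \<in> L1 \<sigma> \<Longrightarrow> weak_L1_norm \<sigma> (toeplitz u f) \<le> A * L1_norm \<sigma> f" and A: "A < \<infinity>"
  shows "toeplitz_bounded \<sigma> u" "weak_opnorm \<sigma> (toeplitz u) \<le> A"
proof -
  show op: "weak_opnorm \<sigma> (toeplitz u) \<le> A"
    unfolding weak_opnorm_def by (rule Inf_lower) (use bound in auto)
  have "toeplitz u f \<in> weak_L1 \<sigma>" if f: "f \<in> L1 \<sigma>" for f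
  proof -
    have "A * L1_norm \<sigma> f < \<infinity>" using A f by (auto simp: L1_def ennreal_mult_less_top)
    then have "weak_L1_norm \<sigma> (toeplitz u f) < \<infinity>" using bound[OF f] by (rule le_less_trans[rotated])
    then show ?thesis using f u by (auto simp: weak_L1_def L1_def intro: toeplitz_measurable)
  qed
  then show "toeplitz_bounded \<sigma> u"
    unfolding toeplitz_bounded_def using int A op by (auto intro: le_less_trans)
qed

theorem theorem1p9:
  fixes \<theta> lam C0 :: real and \<D> :: "'n::finite dyadic_data set"
  assumes "dyadic_family \<theta> lam C0 \<D>"
  shows "\<exists>C::real. C > 0 \<and>
    (\<forall>(u :: complex ^ 'n \<Rightarrow> complex) (r :: real) (\<sigma> :: complex ^ 'n \<Rightarrow> real).
       u \<in> L_infinity \<longrightarrow> r > 1 \<longrightarrow> \<sigma> \<in> uB1 \<theta> \<D> u \<inter> RH \<theta> \<D> r \<longrightarrow>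
       toeplitz_bounded \<sigma> u \<and>
       weak_opnorm \<sigma> (toeplitz u)
         \<le> ennreal C * uB1_char \<theta> \<D> u \<sigma> * RH_char \<theta> \<D> r \<sigma> * ennreal (1 + ln (r / (r - 1))))"
proof -
  note fam = assms[unfolded dyadic_family_def]
  have fin: "finite \<D>" and th: "0 < \<theta>" using fam by auto
  obtain c where c0: "0 < c"
    and kt: "\<And>S p. S \<in> \<D> \<Longrightarrow> p \<in> kube_index S \<Longrightarrow>
      comparable c (emeasure V (kube \<theta> S p)) (emeasure V (dyadic_tent \<theta> S p)) \<and>
      comparable c (emeasure V (dyadic_tent \<theta> S p)) (ennreal ((1 - (norm (kube_center \<theta> S p))\<^sup>2) ^ (CARD('n) + 1)))"
    and ct: "\<And>z. z \<in> unit_ball \<Longrightarrow> \<exists>S\<in>\<D>. \<exists>p\<in>kube_index S.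
      carleson_tent z \<subseteq> dyadic_tent \<theta> S p \<and> comparable c (emeasure V (carleson_tent z)) (emeasure V (dyadic_tent \<theta> S p))"
    using fam by meson
  \<comment> \<open>The comparability constant is enlarged to make \<open>\<rho> = 1 - 1 / c'\<close> positive.\<close>
  define c' where "c' = max c 2"
  have c': "1 < c'" "c \<le> c'" by (auto simp: c'_def)
  have up: "ennreal c * x \<le> ennreal c' * x" for x
    using c' by (intro mult_right_mono ennreal_leI) auto
  define \<rho> where "\<rho> = 1 - 1 / c'"
  have \<rho>: "0 < \<rho>" "\<rho> < 1" using c' by (auto simp: \<rho>_def)
  have tree: "tent_tree V (kube_index S) (dyadic_tent \<theta> S) fst \<rho>" if S: "S \<in> \<D>" for S
  proof -
    interpret dyadic_structure \<theta> lam C0 S by standard (use fam S in auto)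
    show ?thesis unfolding \<rho>_def
    proof (rule is_tent_tree)
      show "1 < c'" by (rule c')
      fix p assume p: "p \<in> kube_index S"
      show "emeasure V (dyadic_tent \<theta> S p) \<le> ennreal c' * emeasure V (kube \<theta> S p)"
        using kt[OF S p] order_trans[OF _ up] by (auto simp: comparable_def)
      show "ennreal ((1 - (norm (kube_center \<theta> S p))\<^sup>2) ^ (CARD('n) + 1)) \<le> ennreal c' * emeasure V (dyadic_tent \<theta> S p)"
        using kt[OF S p] order_trans[OF _ up] by (auto simp: comparable_def)
    qed (use fam S in blast)
  qed
  have tent_V: "A \<in> sets V" "emeasure V A \<noteq> 0" if A: "A \<in> tents \<theta> \<D>" for A
  proof -
    obtain S p where S: "S \<in> \<D>" "p \<in> kube_index S" "A = dyadic_tent \<theta> S p"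
      using A by (auto simp: tents_def)
    interpret tent_tree V "kube_index S" "dyadic_tent \<theta> S" fst \<rho> by (rule tree[OF S(1)])
    show "A \<in> sets V" "emeasure V A \<noteq> 0" using S tent_pos by auto
  qed
  have ball: "unit_ball \<in> tents \<theta> \<D>"
  proof -
    obtain S p where S: "S \<in> \<D>" "p \<in> kube_index S" "carleson_tent 0 \<subseteq> dyadic_tent \<theta> S p"
      using ct[of 0] by auto
    then have "dyadic_tent \<theta> S p = unit_ball" using dyadic_tent_subset[of \<theta> S p] by (auto simp: carleson_tent_def)
    then show ?thesis using S by (auto simp: tents_def)
  qed
  then have ne: "\<D> \<noteq> {}" by (auto simp: tents_def)
  obtain N where N: "\<rho> ^ N < 1/2" using real_arch_pow_inv[of "1/2" \<rho>] \<rho> by auto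
  have "\<exists>S\<in>\<D>. \<exists>p\<in>kube_index S. carleson_tent z \<subseteq> dyadic_tent \<theta> S p \<and>
      emeasure V (dyadic_tent \<theta> S p) \<le> ennreal c * emeasure V (carleson_tent z)" if "z \<in> unit_ball" for z
    using ct[OF that] unfolding comparable_def by blast
  from kernel_sparse_domination[OF fin less_imp_le[OF c0] tree this]
  obtain K where K: "0 < K" and dom: "\<And>z h. z \<in> unit_ball \<Longrightarrow> h \<in> borel_measurable V \<Longrightarrow>
     (\<integral>\<^sup>+w. h w * ennreal (1 / norm (1 - herm z w) ^ (CARD('n) + 1)) \<partial>V)
      \<le> ennreal K * (\<Sum>S\<in>\<D>. \<integral>\<^sup>+p. tent_tree.mean V (dyadic_tent \<theta> S) h p * indicator (dyadic_tent \<theta> S p) z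
            \<partial>count_space (kube_index S))" by blast
  define C where "C = 2 * K * (card \<D>)\<^sup>2 * (1 + 8 * real N * (6 + real N))"
  have C: "0 < C" using K ne fin by (auto simp: C_def card_gt_0_iff intro!: mult_pos_pos add_pos_nonneg)
  have "toeplitz_bounded \<sigma> u \<and> weak_opnorm \<sigma> (toeplitz u)
         \<le> ennreal C * uB1_char \<theta> \<D> u \<sigma> * RH_char \<theta> \<D> r \<sigma> * ennreal (1 + ln (r / (r - 1)))"
    if u: "u \<in> L_infinity" and r: "r > 1" and \<sigma>: "\<sigma> \<in> uB1 \<theta> \<D> u \<inter> RH \<theta> \<D> r"
    for u :: "complex ^ 'n \<Rightarrow> complex" and r :: real and \<sigma> :: "complex ^ 'n \<Rightarrow> real"
  proof -
    let ?B = "uB1_char \<theta> \<D> u \<sigma>" and ?R = "RH_char \<theta> \<D> r \<sigma>" and ?l = "1 + ln (r / (r - 1))"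
    let ?A = "ennreal C * ?B * ?R * ennreal ?l"
    have w: "weight \<sigma>" and B: "?B < \<infinity>" and R: "?R < \<infinity>" using \<sigma> by (auto simp: uB1_def RH_def)
    have [measurable]: "u \<in> borel_measurable V" "\<sigma> \<in> borel_measurable V"
      using u w by (auto simp: L_infinity_def weight_def)
    have A: "?A < \<infinity>" using B R by (simp add: ennreal_mult_less_top)
    have "(\<forall>z\<in>unit_ball. integrable V (toeplitz_integrand u f z)) \<and>
        weak_L1_norm \<sigma> (toeplitz u f) \<le> ?A * L1_norm \<sigma> f" if f: "f \<in> L1 \<sigma>" for f
    proof (cases "AE x in V. u x = 0")
      case True
      have [measurable]: "f \<in> borel_measurable V" using f by (simp add: L1_def)
      have 0: "AE w in V. toeplitz_integrand u f z w = 0" for z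
        using True by eventually_elim (simp add: toeplitz_integrand_def)
      have m: "toeplitz_integrand u f z \<in> borel_measurable V" for z
        by (intro toeplitz_integrand_measurable) auto
      have "integrable V (toeplitz_integrand u f z)" for z
        using integrable_cong_AE[OF m borel_measurable_const 0] by simp
      moreover have "toeplitz u f z = 0" for z
        unfolding toeplitz_def by (rule integral_eq_zero_AE[OF 0])
      then have "weak_L1_norm \<sigma> (toeplitz u f) = 0"
        by (simp add: weak_L1_norm_def wmeasure_def)
      ultimately show ?thesis by simp
    next
      case False
      note nd = nondegenerate_weight[OF w ball B False]
      have [measurable]: "f \<in> borel_measurable V" using f by (simp add: L1_def)
      have "weak_L1_norm \<sigma> (toeplitz u f) \<le> ennreal (C * ?l) * (?B * ?R) * L1_norm \<sigma> f"
        unfolding C_def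
      proof (rule weak_type_toeplitz[OF fin ne tree K dom])
        show "\<rho> ^ N \<le> 1/2" using N by simp
        fix A assume A: "A \<in> tents \<theta> \<D>"
        show "ennreal_root r (avg (\<lambda>x. \<sigma> x powr r) A) \<le> ?R * avg \<sigma> A"
          by (rule reverse_holder_tent[OF w A tent_V[OF A] nd(1)])
        show "AE x in V. x \<in> A \<longrightarrow> avg \<sigma> A * ennreal (norm (u x)) \<le> ?B * ennreal (\<sigma> x)"
          by (rule avg_times_u_le[OF w A tent_V(1)[OF A]])
      qed (use r in auto)
      also have "ennreal (C * ?l) * (?B * ?R) = ?A"
        using C r by (subst ennreal_mult) (auto simp: mult_ac)
      finally show ?thesis using toeplitz_integrand_integrable[OF u w f _ nd(2)] by blast
    qed
    then show ?thesis
      using toeplitz_bounded_if_weak_bound[of u \<sigma> ?A] A by auto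
  qed
  then show ?thesis using C by blast
qed

end
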